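(* Let $b\ge 1$ and $c>0$ be real numbers. Let $\Lambda$ be any purely elliptic convex generator, and let $\eta$ be the line of slope $-1/b$ tangent to $\Lambda$. Then $\Lambda$ is minimal for the ellipsoid $E(bc,c)$ if and only if $\Lambda$ is maximal under $\eta$.
   Context: A convex path is a path $\Lambda$ in the plane with endpoints $(0,y(\Lambda))$ and $(x(\Lambda),0)$, where $x(\Lambda),y(\Lambda)\ge 0$ are real, which is the graph of a piecewise linear concave function $f:[0,x(\Lambda)]\to[0,y(\Lambda)]$ with $f'(0)\le 0$, possibly together with a vertical line segment at the right. Its vertices are its endpoints and the points where its slope changes; its edges are the segments between consecutive vertices. It is a convex integral path if $x(\Lambda),y(\Lambda)$ are integers and all vertices are lattice points. A convex generator is a convex integral path each of whose edges is labeled "$e$" or "$h$", with horizontal and vertical edges labeled only "$e$". It is purely elliptic if all edges are labeled "$e$". A lattice point is enclosed by a path if it lies in the region bounded by the path and the $x$- and $y$-axes, boundary included. $L(\Lambda)$ is the number of lattice points enclosed by $\Lambda$, $h(\Lambda)$ is the number of edges labeled "$h$", and the ECH index is $I(\Lambda)=2(L(\Lambda)-1)-h(\Lambda)$. The ellipsoid $E(bc,c)$ is the toric domain over the triangle $\Omega$ with vertices $(0,0),(bc,0),(0,c)$. The symplectic action of $\Lambda$ with respect to $X_\Omega$ is $A_\Omega(\Lambda)=\sum_{\nu}\det(\vec\nu,\,p_{\Omega,\nu})$, the sum over edges $\nu$ of $\Lambda$, where $\vec\nu$ is the displacement vector of $\nu$ (traversing $\Lambda$ from $(0,y(\Lambda))$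 to $(x(\Lambda),0)$) and $p_{\Omega,\nu}$ is any point on the line parallel to $\vec\nu$ tangent to $\partial\Omega$ (it touches $\partial \Omega$ and $\Omega$ lies entirely in one closed half plane bounded by it; the tangent line meant is the upper-right one). For the ellipsoid this gives $A_{E(bc,c)}(\Lambda)=\max\{cx+bcy : (x,y)\in\Lambda\}$. A convex generator $\Lambda$ is minimal for $X_\Omega$ if it is purely elliptic and it uniquely minimizes $A_\Omega$ among all purely elliptic convex generators with the same ECH index as $\Lambda$. "Line $\eta$ of slope $-1/b$ tangent to $\Lambda$" means that $\eta$ touches $\Lambda$ and $\Lambda$ lies entirely in the closed half plane to the lower left of $\eta$. A convex integral path $\Lambda$ is maximal under a convex path $\Gamma$ (here, the segment of $\eta$ in the closed first quadrant) if $\Lambda$ encloses exactly the lattice points of the closed first quadrant enclosed by $\Gamma$, including those on $\Gamma$. *)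

theory Defs
  imports "HOL-Analysis.Analysis"
begin

type_synonym plane = "real \<times> real"

definition quadrant :: "plane set" where
  "quadrant = {(x, y). 0 \<le> x \<and> 0 \<le> y}"

definition lattice_points :: "plane set" where
  "lattice_points = \<int> \<times> \<int>"

definition det2 :: "plane \<Rightarrow> plane \<Rightarrow> real" where
  "det2 v w = fst v * snd w - snd v * fst w"


text \<open>The finite set \<open>S\<close> contains the possible break points.\<close>

definition piecewise_linear :: "real \<Rightarrow> real \<Rightarrow> (real \<Rightarrow> real) \<Rightarrow> bool" where
  "piecewise_linear a b f \<longleftrightarrow>
     (\<exists>S. finite S \<and>
        (\<forall>s t. a \<le> s \<and> s < t \<and> t \<le> b \<and> {s<..<t} \<inter> S = {} \<longrightarrow>
           (\<exists>m k. \<forall>u\<in>{s..t}. f u = m * u + k)))"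

text \<open>The vertical segment from \<open>(X, f X)\<close> to \<open>(X, 0)\<close> degenerates to a point when \<open>f X = 0\<close>.
  The condition on the one-sided derivative at \<open>0\<close> is meaningless, and omitted, when \<open>X = 0\<close>.\<close>

definition convex_path :: "plane set \<Rightarrow> bool" where
  "convex_path P \<longleftrightarrow>
     (\<exists>X Y f. 0 \<le> X \<and> 0 \<le> Y
        \<and> f \<in> {0..X} \<rightarrow> {0..Y} \<and> f 0 = Y
        \<and> piecewise_linear 0 X f \<and> concave_on {0..X} f
        \<and> (0 < X \<longrightarrow> (\<exists>D\<le>0. (f has_real_derivative D) (at 0 within {0..X})))
        \<and> P = (\<lambda>t. (t, f t)) ` {0..X} \<union> {X} \<times> {0..f X})"

text \<open>Convex paths are compact and monotone, so the endpoints \<open>(0, y_end P)\<close> and \<open>(x_end P, 0)\<close>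
  are given by the largest coordinates.\<close>

definition x_end :: "plane set \<Rightarrow> real" where
  "x_end P = Sup (fst ` P)"

definition y_end :: "plane set \<Rightarrow> real" where
  "y_end P = Sup (snd ` P)"

text \<open>The slope changes at a point when the path is not straight in any neighbourhood of it; this
  includes the upper end of a vertical segment.\<close>

definition path_vertices :: "plane set \<Rightarrow> plane set" where
  "path_vertices P = {(0, y_end P), (x_end P, 0)} \<union>
     {p \<in> P. \<forall>\<epsilon>>0. \<not> collinear (P \<inter> ball p \<epsilon>)}"

text \<open>An edge is the pair of its initial and final vertex in the traversal from \<open>(0, y_end P)\<close> to
  \<open>(x_end P, 0)\<close>, along which the first coordinate never decreases and the second never
  increases.\<close>

type_synonym edge = "plane \<times> plane"

definition path_edges :: "plane set \<Rightarrow> edge set" where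
  "path_edges P = {(p, q). p \<in> path_vertices P \<and> q \<in> path_vertices P \<and> p \<noteq> q
      \<and> fst p \<le> fst q \<and> snd q \<le> snd p
      \<and> \<not> (\<exists>r \<in> path_vertices P - {p, q}.
              fst p \<le> fst r \<and> fst r \<le> fst q \<and> snd q \<le> snd r \<and> snd r \<le> snd p)}"

definition convex_integral_path :: "plane set \<Rightarrow> bool" where
  "convex_integral_path P \<longleftrightarrow>
     convex_path P \<and> x_end P \<in> \<int> \<and> y_end P \<in> \<int> \<and> path_vertices P \<subseteq> lattice_points"

definition enclosed_region :: "plane set \<Rightarrow> plane set" where
  "enclosed_region P = {(x, y). 0 \<le> x \<and> 0 \<le> y \<and> (\<exists>v\<ge>y. (x, v) \<in> P)}"

definition enclosed_lattice_points :: "plane set \<Rightarrow> plane set" where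
  "enclosed_lattice_points P = enclosed_region P \<inter> lattice_points"

definition maximal_under :: "plane set \<Rightarrow> plane set \<Rightarrow> bool" where
  "maximal_under P \<Gamma> \<longleftrightarrow> enclosed_lattice_points P = enclosed_lattice_points \<Gamma>"

definition tangent_line :: "real \<Rightarrow> plane set \<Rightarrow> plane set \<Rightarrow> bool" where
  "tangent_line m P \<eta> \<longleftrightarrow>
     (\<exists>k. \<eta> = {(x, y). y = m * x + k} \<and> \<eta> \<inter> P \<noteq> {} \<and> (\<forall>(x, y)\<in>P. y \<le> m * x + k))"


datatype edge_label = Label_e | Label_h

text \<open>The labelling is a partial map defined exactly on the edges, so that equality of generators
  means equality of the paths and of all labels.\<close>

record generator =
  gen_path :: "plane set"
  gen_label :: "edge \<rightharpoonup> edge_label"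

definition convex_generator :: "generator \<Rightarrow> bool" where
  "convex_generator \<Lambda> \<longleftrightarrow>
     convex_integral_path (gen_path \<Lambda>)
     \<and> dom (gen_label \<Lambda>) = path_edges (gen_path \<Lambda>)
     \<and> (\<forall>(p, q)\<in>path_edges (gen_path \<Lambda>).
          fst p = fst q \<or> snd p = snd q \<longrightarrow> gen_label \<Lambda> (p, q) = Some Label_e)"

definition purely_elliptic :: "generator \<Rightarrow> bool" where
  "purely_elliptic \<Lambda> \<longleftrightarrow> (\<forall>\<nu>\<in>path_edges (gen_path \<Lambda>). gen_label \<Lambda> \<nu> = Some Label_e)"

definition lattice_count :: "generator \<Rightarrow> nat" where
  "lattice_count \<Lambda> = card (enclosed_lattice_points (gen_path \<Lambda>))"

definition h_count :: "generator \<Rightarrow> nat" where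
  "h_count \<Lambda> = card {\<nu>\<in>path_edges (gen_path \<Lambda>). gen_label \<Lambda> \<nu> = Some Label_h}"

definition ech_index :: "generator \<Rightarrow> int" where
  "ech_index \<Lambda> = 2 * (int (lattice_count \<Lambda>) - 1) - int (h_count \<Lambda>)"


text \<open>A toric domain enters only through its moment image \<open>\<Omega>\<close>. For the displacement
  \<open>v = (s, - t)\<close> of an edge, \<open>s, t \<ge> 0\<close>, the inequality below reads
  \<open>s * (snd q - snd p) + t * (fst q - fst p) \<le> 0\<close>, i.e. \<open>\<Omega>\<close> lies to the lower left of the line
  through \<open>p\<close> parallel to \<open>v\<close>.\<close>

definition on_tangent :: "plane set \<Rightarrow> plane \<Rightarrow> plane \<Rightarrow> bool" where
  "on_tangent \<Omega> v p \<longleftrightarrow>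
     (\<exists>t. p + t *\<^sub>R v \<in> frontier \<Omega>) \<and> (\<forall>q\<in>\<Omega>. det2 v (q - p) \<le> 0)"

text \<open>The summand does not depend on the choice of the point on the tangent line.\<close>

definition action :: "plane set \<Rightarrow> generator \<Rightarrow> real" where
  "action \<Omega> \<Lambda> =
     (\<Sum>(p, q)\<in>path_edges (gen_path \<Lambda>). det2 (q - p) (SOME r. on_tangent \<Omega> (q - p) r))"

definition minimal_for :: "plane set \<Rightarrow> generator \<Rightarrow> bool" where
  "minimal_for \<Omega> \<Lambda> \<longleftrightarrow>
     convex_generator \<Lambda> \<and> purely_elliptic \<Lambda>
     \<and> (\<forall>\<Lambda>'. convex_generator \<Lambda>' \<and> purely_elliptic \<Lambda>' \<and> ech_index \<Lambda>' = ech_index \<Lambda> \<and> \<Lambda>' \<noteq> \<Lambda>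
          \<longrightarrow> action \<Omega> \<Lambda> < action \<Omega> \<Lambda>')"

text \<open>The moment image of the ellipsoid \<open>E(a, b)\<close>.\<close>

definition ellipsoid_region :: "real \<Rightarrow> real \<Rightarrow> plane set" where
  "ellipsoid_region a b = convex hull {(0, 0), (a, 0), (0, b)}"

end

theory Submission
  imports Defs
begin

text \<open>
  The action of a generator \<open>\<Lambda>\<close> telescopes along the edges to \<open>c\<close> times the maximum \<open>M\<close> of \<open>x + b y\<close>,
  which is attained at a vertex, and \<open>\<Lambda>\<close> is determined by its enclosed lattice points. Let \<open>T\<close> be the
  set of lattice points of the quadrant with \<open>x + b y \<le> M\<close>.

  If \<open>\<Lambda>\<close> encloses all of \<open>T\<close>, a competitor of the same index and no larger action encloses a subset of
  \<open>T\<close> of the same cardinality, hence \<open>T\<close> itself, and so equals \<open>\<Lambda>\<close>.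

  If \<open>\<Lambda>\<close> is minimal, choose generic weights \<open>\<alpha> < 1\<close> and \<open>\<alpha> > 1\<close>. For each of them the first points
  of \<open>T\<close>, ordered by \<open>\<alpha> x + b y\<close>, as many as \<open>\<Lambda>\<close> encloses, are the enclosed points of a convex integral
  path, whose action is no larger. By minimality this path is \<open>\<Lambda>\<close>. So a point of \<open>T\<close> missed by \<open>\<Lambda>\<close>
  exceeds the maximizing vertex of \<open>\<Lambda>\<close> in both orders and hence, as \<open>1\<close> lies between the two weights,
  with respect to \<open>x + b y\<close>, which is impossible.
\<close>

section \<open>Collinearity, chords of convex functions, and telescoping sums\<close>

lemma collinear_det2:
  assumes "collinear S" "p \<in> S" "q \<in> S" "r \<in> S"
  shows "det2 (p - q) (r - q) = 0"
proof -
  obtain u where u: "\<And>x y. x \<in> S \<Longrightarrow> y \<in> S \<Longrightarrow> \<exists>c. x - y = c *\<^sub>R u"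
    using assms(1) unfolding collinear_def by blast
  obtain c d where "p - q = c *\<^sub>R u" "r - q = d *\<^sub>R u"
    using u assms by meson
  then show ?thesis by (simp add: det2_def)
qed

lemma collinear_graph: "collinear {(x :: real, y :: real). y = m * x + k}"
  unfolding collinear_def
proof (rule exI[of _ "(1, m)"], intro ballI)
  fix p q :: "real \<times> real" assume "p \<in> {(x, y). y = m * x + k}" "q \<in> {(x, y). y = m * x + k}"
  then show "\<exists>c. p - q = c *\<^sub>R (1, m)"
    by (intro exI[of _ "fst p - fst q"]) (auto simp: algebra_simps)
qed

lemma collinear_vertical: "collinear ({a :: real} \<times> (UNIV :: real set))"
  unfolding collinear_def
proof (rule exI[of _ "(0, 1)"], intro ballI)
  fix p q :: "real \<times> real" assume "p \<in> {a} \<times> UNIV" "q \<in> {a} \<times> UNIV"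
  then show "\<exists>c. p - q = c *\<^sub>R (0, 1)"
    by (intro exI[of _ "snd p - snd q"]) auto
qed

lemma norm_plane_le: "norm (x :: real, y :: real) \<le> \<bar>x\<bar> + \<bar>y\<bar>"
  using norm_Pair_le[of x y] by simp

lemma convex_on_chord:
  fixes v :: "real \<Rightarrow> real"
  assumes "convex_on {a..b} v" "s \<in> {a..b}" "a < b"
  shows "(b - a) * v s \<le> (b - s) * v a + (s - a) * v b"
proof -
  define l where "l = (s - a) / (b - a)"
  have l: "0 \<le> l" "l \<le> 1" using assms by (auto simp: l_def field_simps)
  have s: "s = (1 - l) * a + l * b" proof -
    have "l * (b - a) = s - a" using assms by (simp add: l_def)
    then show ?thesis by (simp add: algebra_simps)
  qed
  have "v s \<le> (1 - l) * v a + l * v b"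
    using convex_onD[OF assms(1) l, of a b] assms s by simp
  then have "(b - a) * v s \<le> (b - a) * ((1 - l) * v a + l * v b)"
    using assms by (intro mult_left_mono) auto
  also have "\<dots> = (b - s) * v a + (s - a) * v b"
  proof -
    have l': "l * (b - a) = s - a" using assms by (simp add: l_def)
    have "(b - a) * ((1 - l) * v a + l * v b) = (b - a - l * (b - a)) * v a + l * (b - a) * v b"
      by (simp add: algebra_simps)
    then show ?thesis by (simp add: l')
  qed
  finally show ?thesis .
qed

text \<open>The point \<open>s\<close> may belong to \<open>B\<close> or not; both cases occur, at a
  break point and between two of them.\<close>

lemma finite_set_neighbours:
  fixes B :: "real set"
  assumes "finite B" "l \<in> B" "l < s" "r \<in> B" "s < r"
  obtains a b where "a \<in> B" "b \<in> B" "a < s" "s < b" "{a<..<b} \<inter> B \<subseteq> {s}"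
proof -
  define a where "a = Max {x \<in> B. x < s}"
  define b where "b = Min {x \<in> B. s < x}"
  have a: "a \<in> {x \<in> B. x < s}" unfolding a_def by (rule Max_in) (use assms in auto)
  have b: "b \<in> {x \<in> B. s < x}" unfolding b_def by (rule Min_in) (use assms in auto)
  have "x \<le> a" if "x \<in> B" "x < s" for x
    unfolding a_def using that assms by (intro Max_ge) auto
  moreover have "b \<le> x" if "x \<in> B" "s < x" for x
    unfolding b_def using that assms by (intro Min_le) auto
  ultimately have "{a<..<b} \<inter> B \<subseteq> {s}" by force
  then show thesis using that a b by blast
qed

text \<open>Adding a new maximum \<open>m\<close> creates exactly one new consecutive pair,
  \<open>(Max A, m)\<close>, whose term extends the telescoping sum.\<close>

lemma sum_consecutive:
  fixes A :: "real set" and F :: "real \<Rightarrow> real"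
  assumes "finite A" "A \<noteq> {}"
  shows "(\<Sum>(a, b)\<in>{(a, b). a \<in> A \<and> b \<in> A \<and> a < b \<and> \<not> (\<exists>r\<in>A. a < r \<and> r < b)}. F b - F a)
    = F (Max A) - F (Min A)"
  using assms
proof (induction A rule: finite_linorder_max_induct)
  case empty
  then show ?case by simp
next
  case (insert m A)
  let ?C = "\<lambda>A. {(a, b). a \<in> A \<and> b \<in> A \<and> a < b \<and> \<not> (\<exists>r\<in>A. a < r \<and> r < b)}"
  show ?case
  proof (cases "A = {}")
    case True
    then have C: "?C (insert m A) = {}" by auto
    show ?thesis unfolding C using True by simp
  next
    case False
    have MA: "Max A \<in> A" "\<And>a. a \<in> A \<Longrightarrow> a \<le> Max A"
      using False insert.hyps by auto
    have C: "?C (insert m A) = insert (Max A, m) (?C A)"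
    proof -
      have "(a, b) \<in> ?C (insert m A) \<longleftrightarrow> (a, b) = (Max A, m) \<or> (a, b) \<in> ?C A" for a b
        using MA insert.hyps(2) by (smt (verit, best) case_prod_conv insert_iff mem_Collect_eq old.prod.inject)
      then show ?thesis by (auto simp only: insert_iff set_eq_iff split_paired_All)
    qed
    have fin: "finite (?C A)"
      by (rule finite_subset[of _ "A \<times> A"]) (use insert.hyps in auto)
    have "(Max A, m) \<notin> ?C A" using insert.hyps by auto
    then have "(\<Sum>(a, b)\<in>?C (insert m A). F b - F a)
        = F m - F (Max A) + (F (Max A) - F (Min A))"
      unfolding C using fin insert.IH False by simp
    moreover have "Max (insert m A) = m"
      using insert.hyps by (intro Max_eqI) (auto intro: less_imp_le)
    moreover have "Min (insert m A) = Min A"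
      using insert.hyps False by (simp add: Min_insert min_def) (meson Min_in MA leD less_imp_le)
    ultimately show ?thesis by simp
  qed
qed

section \<open>Convex paths as graphs\<close>

text \<open>In a convex path \<open>Y\<close> equals \<open>f 0\<close>, so the range
  \<open>{0..Y}\<close> turns into the two bounds on \<open>f\<close>; with concavity, the upper one
  yields monotonicity.\<close>

locale convex_graph =
  fixes X :: real and f :: "real \<Rightarrow> real"
  assumes X_nonneg: "0 \<le> X"
    and f_nonneg: "\<And>t. 0 \<le> t \<Longrightarrow> t \<le> X \<Longrightarrow> 0 \<le> f t"
    and f_le_start: "\<And>t. 0 \<le> t \<Longrightarrow> t \<le> X \<Longrightarrow> f t \<le> f 0"
    and pl: "piecewise_linear 0 X f"
    and conc: "concave_on {0..X} f"
begin

definition path :: "plane set" where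
  "path = (\<lambda>t. (t, f t)) ` {0..X} \<union> {X} \<times> {0..f X}"

lemma mem_path: "(x, y) \<in> path \<longleftrightarrow> 0 \<le> x \<and> x \<le> X \<and> (y = f x \<or> x = X \<and> 0 \<le> y \<and> y \<le> f X)"
  using X_nonneg by (auto simp: path_def)

lemma chord:
  assumes "0 \<le> a" "a \<le> s" "s \<le> b" "b \<le> X" "a < b"
  shows "(b - s) * f a + (s - a) * f b \<le> (b - a) * f s"
proof -
  have "convex_on {a..b} (\<lambda>t. - f t)"
    by (rule convex_on_subset[where T="{0..X}"]) (use conc assms in \<open>auto simp: concave_on_def\<close>)
  from convex_on_chord[OF this, of s] show ?thesis using assms by simp
qed

text \<open>By concavity \<open>f s\<close> is at least a weighted mean of \<open>f 0\<close> and
  \<open>f t\<close>, and \<open>f 0 \<ge> f t\<close>.\<close>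

lemma antimono:
  assumes "0 \<le> s" "s \<le> t" "t \<le> X"
  shows "f t \<le> f s"
proof (cases "t = 0")
  case False
  have "t * f t = (t - s) * f t + s * f t" by (simp add: algebra_simps)
  also have "\<dots> \<le> (t - s) * f 0 + s * f t"
    using f_le_start[of t] assms by (intro add_right_mono mult_left_mono) auto
  also have "\<dots> \<le> t * f s" using chord[of 0 s t] assms False by simp
  finally have "t * f t \<le> t * f s" .
  then show ?thesis using assms False by simp
qed (use assms in auto)

lemma x_end: "x_end path = X"
proof -
  have "fst ` path = {0..X}"
    using X_nonneg by (auto simp: path_def image_Un image_image)
  then show ?thesis by (simp add: x_end_def X_nonneg)
qed

lemma y_end: "y_end path = f 0"
  unfolding y_end_def
proof (rule cSup_eq_maximum)
  show "f 0 \<in> snd ` path" using X_nonneg by (intro image_eqI[of _ _ "(0, f 0)"]) (auto simp: mem_path)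
  fix y assume "y \<in> snd ` path"
  then show "y \<le> f 0"
    using f_le_start X_nonneg by (force simp: mem_path)
qed

lemma mem_enclosed:
  "(x, y) \<in> enclosed_region path \<longleftrightarrow> 0 \<le> x \<and> x \<le> X \<and> 0 \<le> y \<and> y \<le> f x"
  by (auto simp: enclosed_region_def mem_path)

lemma vertices_subset: "path_vertices path \<subseteq> path"
  using X_nonneg f_nonneg[of X] by (auto simp: path_vertices_def x_end y_end mem_path)

lemma ends_vertices: "(0, f 0) \<in> path_vertices path" "(X, 0) \<in> path_vertices path"
  by (auto simp: path_vertices_def x_end y_end)

lemma vertexI:
  assumes "p \<in> path" "\<And>\<epsilon>. \<epsilon> > 0 \<Longrightarrow> \<not> collinear (path \<inter> ball p \<epsilon>)"
  shows "p \<in> path_vertices path"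
  using assms by (auto simp: path_vertices_def)

lemma snd_nonneg: "p \<in> path \<Longrightarrow> 0 \<le> snd p"
  using f_nonneg X_nonneg by (cases p) (auto simp: mem_path)

text \<open>The quantity \<open>x - y\<close> increases strictly along a convex path, so it orders the points of the path.\<close>

lemma chain:
  assumes "p \<in> path" "q \<in> path" "fst p - snd p \<le> fst q - snd q"
  shows "fst p \<le> fst q \<and> snd q \<le> snd p"
proof (cases p, cases q)
  fix x y x' y' assume pq: "p = (x, y)" "q = (x', y')"
  have *: "b \<le> f a" if "(a, b) \<in> path" for a b
    using that by (auto simp: mem_path)
  consider "x < x'" | "x' < x" | "x = x'" by linarith
  then show ?thesis
  proof cases
    case 1
    then have "y = f x" "0 \<le> x" "x' \<le> X" using assms pq by (auto simp: mem_path)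
    then show ?thesis using antimono[of x x'] * [of x' y'] assms(2) 1 pq by auto
  next
    case 2
    then have "y' = f x'" "0 \<le> x'" "x \<le> X" using assms pq by (auto simp: mem_path)
    then show ?thesis using antimono[of x' x] * [of x y] assms 2 pq by auto
  next
    case 3
    then show ?thesis using assms pq by auto
  qed
qed

lemma chain_inj:
  assumes "p \<in> path" "q \<in> path" "fst p - snd p = fst q - snd q"
  shows "p = q"
  using chain[of p q] chain[of q p] assms by (auto intro: prod_eqI)

text \<open>Edges become the consecutive pairs of a linear order on the vertices, the form in which
  a sum over edges telescopes.\<close>

lemma edges_eq:
  "path_edges path = {(p, q). p \<in> path_vertices path \<and> q \<in> path_vertices path
     \<and> fst p - snd p < fst q - snd q
     \<and> \<not> (\<exists>r \<in> path_vertices path. fst p - snd p < fst r - snd r \<and> fst r - snd r < fst q - snd q)}"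
  (is "_ = ?R")
proof -
  have "(p, q) \<in> path_edges path \<longleftrightarrow> (p, q) \<in> ?R" for p q
  proof (cases "p \<in> path_vertices path \<and> q \<in> path_vertices path")
    case True
    then have pq: "p \<in> path" "q \<in> path" using vertices_subset by auto
    have 1: "(a \<noteq> c \<and> fst a \<le> fst c \<and> snd c \<le> snd a) \<longleftrightarrow> fst a - snd a < fst c - snd c"
      if "a \<in> path" "c \<in> path" for a c
      using chain[OF that] chain_inj[OF that] by (auto simp: prod_eq_iff)
    have 2: "(r \<in> path_vertices path - {p, q} \<and> fst p \<le> fst r \<and> fst r \<le> fst q \<and> snd q \<le> snd r \<and> snd r \<le> snd p)
      \<longleftrightarrow> (r \<in> path_vertices path \<and> fst p - snd p < fst r - snd r \<and> fst r - snd r < fst q - snd q)" for r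
      using 1[of p r] 1[of r q] pq vertices_subset by auto
    show ?thesis
      unfolding path_edges_def using True 1[OF pq] 2 by blast
  qed (auto simp: path_edges_def)
  then show ?thesis by (auto simp only: set_eq_iff split_paired_All)
qed

text \<open>The leftmost break point maximizing \<open>f + u\<close> is a vertex: if \<open>f\<close> were affine near it, then
  \<open>f + u\<close> would be convex there and hence would also be maximal further to the left.\<close>

lemma exists_maximal_vertex:
  assumes u: "convex_on {0..X} u"
  obtains t where "t \<in> {0..X}" "(t, f t) \<in> path_vertices path"
    "\<And>s. s \<in> {0..X} \<Longrightarrow> f s + u s \<le> f t + u t"
proof -
  obtain S where S: "finite S" and
    aff: "\<And>s t. 0 \<le> s \<Longrightarrow> s < t \<Longrightarrow> t \<le> X \<Longrightarrow> {s<..<t} \<inter> S = {} \<Longrightarrow> \<exists>m k. \<forall>r\<in>{s..t}. f r = m * r + k"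
    using pl unfolding piecewise_linear_def by blast
  define B where "B = insert 0 (insert X (S \<inter> {0..X}))"
  have B: "finite B" "0 \<in> B" "X \<in> B" "\<And>s. s \<in> B \<Longrightarrow> 0 \<le> s \<and> s \<le> X"
    using S X_nonneg by (auto simp: B_def)
  have affB: "\<exists>m k. \<forall>r\<in>{s..t}. f r = m * r + k" if "0 \<le> s" "s < t" "t \<le> X" "{s<..<t} \<inter> B = {}" for s t
  proof (rule aff[OF that(1-3)])
    show "{s<..<t} \<inter> S = {}" using that unfolding B_def by fastforce
  qed
  define v where "v = (\<lambda>s. f s + u s)"
  \<comment> \<open>Between neighbouring points of \<open>B\<close> the function \<open>f\<close> is
    affine, so \<open>f + u\<close> is convex along with \<open>u\<close>.\<close>
  have conv: "convex_on {s..t} v" if st: "0 \<le> s" "s < t" "t \<le> X" "{s<..<t} \<inter> B = {}" for s t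
  proof -
    obtain m k where mk: "\<And>r. r \<in> {s..t} \<Longrightarrow> f r = m * r + k" using affB[OF st] by blast
    have cu: "convex_on {s..t} u"
      by (rule convex_on_subset[OF u]) (use st in auto)
    show ?thesis
    proof (intro convex_onI)
      fix l x y :: real assume l: "0 < l" "l < 1" and xy: "x \<in> {s..t}" "y \<in> {s..t}"
      have z: "(1 - l) *\<^sub>R x + l *\<^sub>R y \<in> {s..t}"
        using convexD_alt[OF convex_real_interval(5)[of s t] xy, of l] l by simp
      show "v ((1 - l) *\<^sub>R x + l *\<^sub>R y) \<le> (1 - l) * v x + l * v y"
        using convex_onD[OF cu, of l x y] l xy mk[OF z] mk[OF xy(1)] mk[OF xy(2)]
        by (simp add: v_def algebra_simps)
    qed auto
  qed
  define m where "m = Max (v ` B)"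
  have mB: "v s \<le> m" if "s \<in> B" for s unfolding m_def using B that by simp
  have m_in: "m \<in> v ` B" unfolding m_def using B by (intro Max_in) auto
  define t where "t = Min {s \<in> B. v s = m}"
  have t: "t \<in> {s \<in> B. v s = m}"
    unfolding t_def using B m_in by (intro Min_in) auto
  have t_least: "v s < m" if "s \<in> B" "s < t" for s
  proof -
    have "t \<le> s" if "v s = m"
      unfolding t_def using that \<open>s \<in> B\<close> B by (intro Min_le) auto
    then have "v s \<noteq> m" using that by auto
    then show ?thesis using mB[OF that(1)] by simp
  qed
  have max: "v s \<le> m" if s: "s \<in> {0..X}" for s
  proof (cases "s \<in> B")
    case False
    then have "0 < s" "s < X" using s B by (auto simp: less_le)
    then obtain a b where ab: "a \<in> B" "b \<in> B" "a < s" "s < b" "{a<..<b} \<inter> B \<subseteq> {s}"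
      using finite_set_neighbours[of B 0 s X] B by blast
    then have "{a<..<b} \<inter> B = {}" using False by auto
    then have "(b - a) * v s \<le> (b - s) * v a + (s - a) * v b"
      using ab B by (intro convex_on_chord conv) auto
    also have "\<dots> \<le> (b - s) * m + (s - a) * m"
      using ab mB by (intro add_mono mult_left_mono) auto
    finally show ?thesis using ab by (simp add: algebra_simps flip: distrib_left) (smt (verit) mult_le_cancel_left_pos left_diff_distrib)
  qed (rule mB)
  have t0: "0 \<le> t" "t \<le> X" using t B by auto
  then have tp: "(t, f t) \<in> path" by (simp add: mem_path)
  have vert: "(t, f t) \<in> path_vertices path"
  proof -
    \<comment> \<open>The first two cases are end points of the path, vertices by definition. There
      remain the top of a vertical segment and an interior break point.\<close>
    consider "t = 0" | "0 < t" "t = X" "f X = 0" | "0 < t" "t = X" "f X > 0" | "0 < t" "t < X"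
      using t0 f_nonneg[of X] X_nonneg by linarith
    then show ?thesis
    proof cases
      case 3
      show ?thesis
      proof (rule vertexI[OF tp])
        fix \<epsilon> :: real assume \<epsilon>: "\<epsilon> > 0"
        \<comment> \<open>\<open>X\<close> is the largest element of \<open>B\<close>; the auxiliary
          \<open>X + 1\<close> serves as its right neighbour.\<close>
        have "finite (insert (X + 1) B)" "0 \<in> insert (X + 1) B" "0 < X"
          "X + 1 \<in> insert (X + 1) B" "X < X + 1"
          using B 3 by auto
        then obtain a b where ab:
            "a \<in> insert (X + 1) B" "b \<in> insert (X + 1) B" "a < X" "X < b" "{a<..<b} \<inter> insert (X + 1) B \<subseteq> {X}"
          by (rule finite_set_neighbours)
        have a: "a \<in> B" "a < X" using ab by auto
        have gap: "{a<..<X} \<inter> B = {}"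
        proof -
          have "{a<..<X} \<inter> B \<subseteq> {a<..<b} \<inter> insert (X + 1) B" using ab(4) by auto
          also have "\<dots> \<subseteq> {X}" by (rule ab(5))
          finally show ?thesis by auto
        qed
        obtain n k where nk: "\<And>r. r \<in> {a..X} \<Longrightarrow> f r = n * r + k"
          using affB[of a X] a gap B by blast
        \<comment> \<open>The three bounds keep \<open>X - \<delta>\<close> in the last affine
          piece, the point \<open>\<delta>\<close> below the corner on the vertical segment, and
          both points in the ball.\<close>
        define \<delta> where "\<delta> = min (min (X - a) (f X)) (\<epsilon> / (2 * (1 + \<bar>n\<bar>)))"
        have \<delta>: "0 < \<delta>" "\<delta> \<le> X - a" "\<delta> \<le> f X" using a 3 \<epsilon> by (auto simp: \<delta>_def)
        have "\<delta> * (1 + \<bar>n\<bar>) \<le> \<epsilon> / (2 * (1 + \<bar>n\<bar>)) * (1 + \<bar>n\<bar>)"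
          by (intro mult_right_mono) (auto simp: \<delta>_def)
        also have "\<dots> < \<epsilon>" using \<epsilon> by (simp add: field_simps add_pos_nonneg)
        finally have \<delta>\<epsilon>: "\<delta> * (1 + \<bar>n\<bar>) < \<epsilon>" .
        have \<delta>\<epsilon>': "\<delta> < \<epsilon>" using \<delta>\<epsilon> \<delta> by (simp add: algebra_simps) (smt (verit) mult_nonneg_nonneg)
        have fd: "f X - f (X - \<delta>) = n * \<delta>" using nk[of X] nk[of "X - \<delta>"] \<delta> a by (simp add: algebra_simps)
        have "dist (X, f X) (X - \<delta>, f (X - \<delta>)) \<le> \<bar>\<delta>\<bar> + \<bar>n * \<delta>\<bar>"
          unfolding dist_norm diff_Pair fd using norm_plane_le[of \<delta> "n * \<delta>"] by simp
        also have "\<dots> < \<epsilon>" using \<delta>\<epsilon> \<delta> by (simp add: abs_mult algebra_simps)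
        finally have 1: "(X - \<delta>, f (X - \<delta>)) \<in> path \<inter> ball (X, f X) \<epsilon>"
          using \<delta> a B(4)[of a] by (simp add: mem_path)
        have 2: "(X, f X - \<delta>) \<in> path \<inter> ball (X, f X) \<epsilon>"
          using \<delta> X_nonneg \<delta>\<epsilon>' by (auto simp: mem_path dist_norm norm_Pair)
        have 3: "(X, f X) \<in> path \<inter> ball (X, f X) \<epsilon>"
          using X_nonneg \<epsilon> by (auto simp: mem_path)
        show "\<not> collinear (path \<inter> ball (t, f t) \<epsilon>)"
        proof
          assume "collinear (path \<inter> ball (t, f t) \<epsilon>)"
          then have "collinear (path \<inter> ball (X, f X) \<epsilon>)" using \<open>t = X\<close> by simp
          from collinear_det2[OF this 1 3 2] show False using \<delta> by (simp add: det2_def)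
        qed
      qed
    next
      case 4
      show ?thesis
      proof (rule vertexI[OF tp], rule notI)
        fix \<epsilon> :: real assume \<epsilon>: "\<epsilon> > 0" and col: "collinear (path \<inter> ball (t, f t) \<epsilon>)"
        obtain a b where ab: "a \<in> B" "b \<in> B" "a < t" "t < b" "{a<..<b} \<inter> B \<subseteq> {t}"
          using finite_set_neighbours[of B 0 t X] B 4 by blast
        have "r = t" if "r \<in> B" "a < r" "r < b" for r using ab(5) that by auto
        then have gaps: "{a<..<t} \<inter> B = {}" "{t<..<b} \<inter> B = {}" using ab(3,4) by fastforce+
        obtain n k where nk: "\<And>r. r \<in> {a..t} \<Longrightarrow> f r = n * r + k"
          using affB[of a t] ab B gaps t0 by (meson)
        obtain n' k' where nk': "\<And>r. r \<in> {t..b} \<Longrightarrow> f r = n' * r + k'"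
          using affB[of t b] ab B gaps t0 by (meson)
        define K where "K = 1 + \<bar>n\<bar> + \<bar>n'\<bar>"
        have K: "K \<ge> 1" by (simp add: K_def)
        define d where "d = \<epsilon> / K"
        have d: "0 < d" "d * K = \<epsilon>" using \<epsilon> K by (simp_all add: d_def)
        define \<delta> where "\<delta> = min (min (t - a) (b - t)) d / 2"
        have \<delta>: "0 < \<delta>" "\<delta> < t - a" "\<delta> < b - t" "\<delta> < d"
          using ab d by (auto simp: \<delta>_def min_def)
        have \<delta>\<epsilon>: "\<delta> * K < \<epsilon>" using \<delta> d K by (simp flip: d(2))
        have lt: "\<delta> + \<bar>n * \<delta>\<bar> < \<epsilon>" "\<delta> + \<bar>n' * \<delta>\<bar> < \<epsilon>"
          using \<delta>\<epsilon> \<delta> by (simp_all add: K_def abs_mult algebra_simps) (smt (verit) mult_nonneg_nonneg)+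
        have fd: "f t - f (t - \<delta>) = n * \<delta>" using nk[of t] nk[of "t - \<delta>"] \<delta> ab by (simp add: algebra_simps)
        have fd': "f t - f (t + \<delta>) = - (n' * \<delta>)" using nk'[of t] nk'[of "t + \<delta>"] \<delta> ab by (simp add: algebra_simps)
        have aX: "0 \<le> a" "b \<le> X" using ab B by auto
        have "dist (t, f t) (t - \<delta>, f (t - \<delta>)) < \<epsilon>"
          unfolding dist_norm diff_Pair fd using norm_plane_le[of \<delta> "n * \<delta>"] lt \<delta> by simp
        then have 1: "(t - \<delta>, f (t - \<delta>)) \<in> path \<inter> ball (t, f t) \<epsilon>"
          using \<delta> aX by (auto simp: mem_path)
        have "dist (t, f t) (t + \<delta>, f (t + \<delta>)) < \<epsilon>"
          unfolding dist_norm diff_Pair fd' using norm_plane_le[of "- \<delta>" "- (n' * \<delta>)"] lt \<delta> by simp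
        then have 2: "(t + \<delta>, f (t + \<delta>)) \<in> path \<inter> ball (t, f t) \<epsilon>"
          using \<delta> aX by (auto simp: mem_path)
        have 3: "(t, f t) \<in> path \<inter> ball (t, f t) \<epsilon>" using tp \<epsilon> by simp
        \<comment> \<open>Collinearity makes the second difference of \<open>f\<close> vanish.
          Convexity of \<open>u\<close> then gives \<open>v (t - \<delta>) \<ge> m\<close>, although
          convexity of \<open>v\<close> on \<open>{a..t}\<close> and \<open>v a < m\<close> force a
          smaller value.\<close>
        have "\<delta> * (f (t - \<delta>) + f (t + \<delta>) - 2 * f t) = 0"
          using collinear_det2[OF col 2 3 1] by (simp add: det2_def algebra_simps)
        then have f2: "f (t - \<delta>) + f (t + \<delta>) = 2 * f t" using \<delta> by simp
        have "2 * u t \<le> u (t - \<delta>) + u (t + \<delta>)"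
          using convex_onD[OF u, of "1/2" "t - \<delta>" "t + \<delta>"] \<delta> aX by (simp add: field_simps)
        then have "2 * m \<le> v (t - \<delta>) + v (t + \<delta>)" using f2 t by (simp add: v_def)
        moreover have "v (t + \<delta>) \<le> m" using max[of "t + \<delta>"] \<delta> aX by simp
        ultimately have ge: "m \<le> v (t - \<delta>)" by simp
        have "(t - a) * v (t - \<delta>) \<le> \<delta> * v a + (t - \<delta> - a) * v t"
          using convex_on_chord[OF conv[of a t], of "t - \<delta>"] gaps ab aX t0 \<delta> by simp
        also have "\<dots> < \<delta> * m + (t - \<delta> - a) * m"
          using t_least[of a] ab \<delta> t by simp
        also have "\<dots> = (t - a) * m" by (simp add: algebra_simps)
        finally show False using ge ab by simp
      qed
    qed (use ends_vertices in auto)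
  qed
  show thesis
    using that[of t] t0 vert max t by (auto simp: v_def)
qed

end

lemma convex_path_graph:
  assumes "convex_path P"
  obtains X f where "convex_graph X f" "P = convex_graph.path X f"
proof -
  obtain X Y f where *: "0 \<le> X" "0 \<le> Y" "f \<in> {0..X} \<rightarrow> {0..Y}" "f 0 = Y"
    "piecewise_linear 0 X f" "concave_on {0..X} f"
    "P = (\<lambda>t. (t, f t)) ` {0..X} \<union> {X} \<times> {0..f X}"
    using assms unfolding convex_path_def by (elim exE conjE) (rule that; assumption)
  have g: "convex_graph X f"
    using * by unfold_locales (auto simp: Pi_iff)
  show thesis
    using that[OF g] *(7) by (simp add: convex_graph.path_def[OF g])
qed

section \<open>The action with respect to an ellipsoid\<close>

text \<open>The injective key \<open>\<sigma>\<close> moves the sum to the reals; \<open>u\<close>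
  and \<open>w\<close> carry its least and greatest values.\<close>

lemma sum_chain:
  fixes V :: "'a set" and F \<sigma> :: "'a \<Rightarrow> real"
  assumes V: "finite V" "inj_on \<sigma> V" and uw: "u \<in> V" "w \<in> V"
    and bounds: "\<And>r. r \<in> V \<Longrightarrow> \<sigma> u \<le> \<sigma> r \<and> \<sigma> r \<le> \<sigma> w"
  shows "(\<Sum>(p, q)\<in>{(p, q). p \<in> V \<and> q \<in> V \<and> \<sigma> p < \<sigma> q \<and> \<not> (\<exists>r\<in>V. \<sigma> p < \<sigma> r \<and> \<sigma> r < \<sigma> q)}.
    F q - F p) = F w - F u"
proof -
  let ?g = "inv_into V \<sigma>"
  have g: "?g (\<sigma> p) = p" if "p \<in> V" for p using V that by simp
  have "(\<Sum>(p, q)\<in>{(p, q). p \<in> V \<and> q \<in> V \<and> \<sigma> p < \<sigma> q \<and> \<not> (\<exists>r\<in>V. \<sigma> p < \<sigma> r \<and> \<sigma> r < \<sigma> q)}. F q - F p)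
    = (\<Sum>(a, b)\<in>{(a, b). a \<in> \<sigma> ` V \<and> b \<in> \<sigma> ` V \<and> a < b \<and> \<not> (\<exists>r\<in>\<sigma> ` V. a < r \<and> r < b)}.
        F (?g b) - F (?g a))"
    by (rule sum.reindex_bij_witness[where j = "\<lambda>(p, q). (\<sigma> p, \<sigma> q)" and i = "\<lambda>(a, b). (?g a, ?g b)"])
      (auto simp: g)
  also have "\<dots> = F (?g (Max (\<sigma> ` V))) - F (?g (Min (\<sigma> ` V)))"
    using sum_consecutive[of "\<sigma> ` V" "\<lambda>a. F (?g a)"] V uw by blast
  also have "Max (\<sigma> ` V) = \<sigma> w" using V uw bounds by (intro Max_eqI) auto
  also have "Min (\<sigma> ` V) = \<sigma> u" using V uw bounds by (intro Min_eqI) auto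
  finally show ?thesis using g uw by simp
qed

text \<open>\<open>det2 (s, - t)\<close> is linear, so the bound describes a half plane, and the
  triangle lies in it as soon as its three corners do.\<close>

lemma det2_ellipsoid_le:
  assumes q: "q \<in> ellipsoid_region (b * c) c" and st: "s \<ge> 0" "t \<ge> 0" and bc: "b > 0" "c > 0"
  shows "det2 (s, - t) q \<le> c * max s (b * t)"
proof -
  let ?H = "{q. det2 (s, - t) q \<le> c * max s (b * t)}"
  have eq: "?H = {q. (t, s) \<bullet> q \<le> c * max s (b * t)}"
    by (auto simp: det2_def inner_prod_def algebra_simps)
  have "convex ?H" unfolding eq by (rule convex_halfspace_le)
  moreover have "{(0, 0), (b * c, 0), (0, c)} \<subseteq> ?H"
    using st bc by (auto simp: det2_def max_def algebra_simps mult_left_mono)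
  ultimately have "ellipsoid_region (b * c) c \<subseteq> ?H"
    unfolding ellipsoid_region_def by (intro hull_minimal)
  then show ?thesis using q by blast
qed

lemma closed_ellipsoid_region: "closed (ellipsoid_region a b)"
  unfolding ellipsoid_region_def by (intro compact_imp_closed finite_imp_compact_convex_hull) auto

lemma ellipsoid_vertex_frontier:
  assumes bc: "b > 0" "c > 0" and p: "p \<in> {(b * c, 0), (0, c)}"
  shows "p \<in> frontier (ellipsoid_region (b * c) c)"
proof -
  let ?\<Omega> = "ellipsoid_region (b * c) c"
  have "p \<in> ?\<Omega>" using p unfolding ellipsoid_region_def by (auto intro: hull_inc)
  moreover have "p \<notin> interior ?\<Omega>"
  proof
    assume "p \<in> interior ?\<Omega>"
    then obtain e where e: "e > 0" "ball p e \<subseteq> ?\<Omega>" by (auto simp: mem_interior)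
    \<comment> \<open>Stepping to the right leaves the half plane bounded by the hypotenuse, whose
      direction is \<open>(b, - 1)\<close>.\<close>
    have "p + (e / 2, 0) \<in> ball p e" using e by (simp add: dist_norm norm_Pair)
    then have "det2 (b, - 1) (p + (e / 2, 0)) \<le> c * max b (b * 1)"
      using e bc by (intro det2_ellipsoid_le) auto
    then show False using p e by (auto simp: det2_def)
  qed
  ultimately show ?thesis by (simp add: frontier_def closure_closed[OF closed_ellipsoid_region])
qed

text \<open>Every admissible \<open>r\<close> gives the maximum of \<open>det2 v\<close> over the
  triangle: the line through \<open>r\<close> meets the triangle, and the triangle lies on one side
  of it. The corner \<open>r0\<close> shows that an admissible point exists.\<close>

lemma det2_some_tangent:
  assumes v: "v = (s, - t)" and st: "s \<ge> 0" "t \<ge> 0" and bc: "b > 0" "c > 0"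
  shows "det2 v (SOME r. on_tangent (ellipsoid_region (b * c) c) v r) = c * max s (b * t)"
proof -
  let ?\<Omega> = "ellipsoid_region (b * c) c"
  have \<Omega>: "(b * c, 0) \<in> ?\<Omega>" "(0, c) \<in> ?\<Omega>"
    unfolding ellipsoid_region_def by (auto intro: hull_inc)
  have diff: "det2 v (q - r) = det2 v q - det2 v r" for q r by (simp add: det2_def algebra_simps)
  define r0 where "r0 = (if b * t \<le> s then (0, c) else (b * c, 0))"
  have "det2 v r0 = c * max s (b * t)"
    by (simp add: r0_def v det2_def max_def)
  then have tangent: "on_tangent ?\<Omega> v r0"
    unfolding on_tangent_def diff
    using ellipsoid_vertex_frontier[OF bc, of r0] det2_ellipsoid_le[OF _ st bc] v
    by (auto intro!: exI[of _ 0] simp: r0_def)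
  define r where "r = (SOME r. on_tangent ?\<Omega> v r)"
  have "on_tangent ?\<Omega> v r" unfolding r_def using tangent by (rule someI[where P = "on_tangent ?\<Omega> v"])
  then have "\<exists>l. r + l *\<^sub>R v \<in> frontier ?\<Omega>" and r: "\<And>q. q \<in> ?\<Omega> \<Longrightarrow> det2 v q \<le> det2 v r"
    unfolding on_tangent_def diff by simp_all
  then obtain l where l: "r + l *\<^sub>R v \<in> frontier ?\<Omega>" by blast
  have "r + l *\<^sub>R v \<in> ?\<Omega>" using l closed_ellipsoid_region by (meson frontier_subset_closed subsetD)
  then have "det2 v (r + l *\<^sub>R v) \<le> c * max s (b * t)"
    unfolding v using st bc by (intro det2_ellipsoid_le)
  moreover have "det2 v (r + l *\<^sub>R v) = det2 v r" by (simp add: det2_def algebra_simps)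
  moreover have "c * max s (b * t) \<le> det2 v r"
    using r[OF \<Omega>(1)] r[OF \<Omega>(2)] by (auto simp: v det2_def max_def mult_ac)
  ultimately show ?thesis by (simp add: r_def)
qed

lemma lattice_box_finite: "finite (({a..b} \<times> {c..d}) \<inter> lattice_points)"
proof (rule finite_subset)
  show "({a..b} \<times> {c..d}) \<inter> lattice_points
      \<subseteq> (\<lambda>(i, j). (of_int i, of_int j)) ` ({\<lfloor>a\<rfloor>..\<lceil>b\<rceil>} \<times> {\<lfloor>c\<rfloor>..\<lceil>d\<rceil>})"
  proof
    fix p assume p: "p \<in> ({a..b} \<times> {c..d}) \<inter> lattice_points"
    then obtain i j :: int where "p = (of_int i, of_int j)"
      by (auto simp: lattice_points_def elim!: Ints_cases)
    then show "p \<in> (\<lambda>(i, j). (of_int i, of_int j)) ` ({\<lfloor>a\<rfloor>..\<lceil>b\<rceil>} \<times> {\<lfloor>c\<rfloor>..\<lceil>d\<rceil>})"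
      using p by (intro image_eqI[of _ _ "(i, j)"]) (auto simp: le_ceiling_iff floor_le_iff)
  qed
qed simp

context convex_graph
begin

lemma enclosed_finite: "finite (enclosed_lattice_points path)"
  by (rule finite_subset[OF _ lattice_box_finite[of 0 X 0 "f 0"]])
    (use f_le_start in \<open>force simp: enclosed_lattice_points_def mem_enclosed\<close>)

lemma vertex_enclosed: "path_vertices path \<subseteq> enclosed_region path"
  using vertices_subset f_nonneg X_nonneg by (fastforce simp: mem_enclosed mem_path)

lemma vertices_finite:
  assumes "path_vertices path \<subseteq> lattice_points"
  shows "finite (path_vertices path)"
  by (rule finite_subset[OF _ enclosed_finite])
    (use vertex_enclosed assms in \<open>simp add: enclosed_lattice_points_def\<close>)

text \<open>Along the path \<open>x + b y\<close> never decreases up to \<open>w\<close> and never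
  increases after it. This decides which term of \<open>max s (b * t)\<close> an edge contributes,
  and the sum telescopes on either side of \<open>w\<close>.\<close>

lemma action_eq_max:
  assumes int: "path_vertices path \<subseteq> lattice_points" and bc: "b > 0" "c > 0"
  obtains w where "w \<in> path_vertices path"
    "\<And>p. p \<in> enclosed_region path \<Longrightarrow> fst p + b * snd p \<le> fst w + b * snd w"
    "\<And>\<Lambda>. gen_path \<Lambda> = path \<Longrightarrow> action (ellipsoid_region (b * c) c) \<Lambda> = c * (fst w + b * snd w)"
proof -
  \<comment> \<open>Maximizing \<open>f s + s / b\<close> amounts to maximizing
    \<open>s + b * f s\<close>; the linear term is convex, so a vertex attains the maximum.\<close>
  have "convex_on {0..X} (\<lambda>s. s / b)"
    by (intro convex_onI) (auto simp: algebra_simps add_divide_distrib diff_divide_distrib)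
  then obtain t where t: "t \<in> {0..X}" "(t, f t) \<in> path_vertices path"
    "\<And>s. s \<in> {0..X} \<Longrightarrow> f s + s / b \<le> f t + t / b"
    using exists_maximal_vertex by blast
  have max: "s + b * f s \<le> t + b * f t" if "0 \<le> s" "s \<le> X" for s
  proof -
    have "b * (f s + s / b) \<le> b * (f t + t / b)"
      using t(3)[of s] that bc by (intro mult_left_mono) auto
    then show ?thesis using bc by (simp add: algebra_simps)
  qed
  let ?V = "path_vertices path"
  let ?\<sigma> = "\<lambda>p :: plane. fst p - snd p"
  let ?\<phi> = "\<lambda>p :: plane. fst p + b * snd p"
  define w where "w = (t, f t)"
  have w: "w \<in> ?V" "w \<in> path" using t vertices_subset by (auto simp: w_def)
  have path_le: "snd p \<le> f (fst p) \<and> 0 \<le> fst p \<and> fst p \<le> X" if "p \<in> path" for p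
    using that by (cases p) (auto simp: mem_path)
  have \<phi>_le: "?\<phi> p \<le> ?\<phi> w" if "p \<in> enclosed_region path" for p
  proof -
    have "0 \<le> fst p" "fst p \<le> X" "b * snd p \<le> b * f (fst p)"
      using that bc by (cases p; auto simp: mem_enclosed)+
    then show ?thesis using max[of "fst p"] by (simp add: w_def)
  qed
  \<comment> \<open>The abscissa of \<open>q\<close> lies between those of \<open>p\<close> and
    \<open>w\<close>, so by concavity the value at \<open>q\<close> is at least a mean of a value no
    less than that at \<open>p\<close> and the maximum.\<close>
  have before: "?\<phi> p \<le> ?\<phi> q" if pq: "p \<in> path" "q \<in> path" "?\<sigma> p < ?\<sigma> q" "?\<sigma> q \<le> ?\<sigma> w" for p q
  proof -
    have ch: "fst p \<le> fst q" "fst q \<le> t"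
      using chain[OF pq(1,2)] chain[OF pq(2) w(2)] pq by (auto simp: w_def)
    \<comment> \<open>Since \<open>w\<close> is on the graph, a point that does not come after
      \<open>w\<close> cannot lie below the top of the vertical segment.\<close>
    have q: "snd q = f (fst q)"
    proof (cases "fst q = X")
      case True
      then have "t = X" using ch t by auto
      then show ?thesis
        using chain[OF pq(2) w(2) pq(4)] path_le[OF pq(2)] True by (auto simp: w_def)
    next
      case False then show ?thesis using pq(2) by (cases q) (auto simp: mem_path)
    qed
    show ?thesis
    proof (cases "fst p = fst q")
      case True
      then show ?thesis using q path_le[OF pq(1)] bc by simp
    next
      case False
      have r: "0 \<le> fst p" "t \<le> X" using path_le[OF pq(1)] t by auto
      have le: "?\<phi> p \<le> fst p + b * f (fst p)" using path_le[OF pq(1)] bc by simp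
      let ?d = "t - fst p"
      have "?d * (fst p + b * f (fst p)) \<le> (t - fst q) * (fst p + b * f (fst p)) + (fst q - fst p) * (t + b * f t)"
        using mult_left_mono[OF max[of "fst p"], of "fst q - fst p"] r ch by (simp add: algebra_simps)
      also have "\<dots> = ?d * fst q + b * ((t - fst q) * f (fst p) + (fst q - fst p) * f t)"
        by (simp add: algebra_simps)
      also have "\<dots> \<le> ?d * fst q + b * (?d * f (fst q))"
        using chord[of "fst p" "fst q" t] r ch False bc by (intro add_left_mono mult_left_mono) auto
      also have "\<dots> = ?d * ?\<phi> q" using q by (simp add: algebra_simps)
      finally show ?thesis using ch False le by simp
    qed
  qed
  have after: "?\<phi> q \<le> ?\<phi> p" if pq: "p \<in> path" "q \<in> path" "?\<sigma> p < ?\<sigma> q" "?\<sigma> w \<le> ?\<sigma> p" for p q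
  proof -
    have ch: "fst p \<le> fst q" "t \<le> fst p" "snd q \<le> snd p"
      using chain[OF pq(1,2)] chain[OF w(2) pq(1)] pq by (auto simp: w_def)
    show ?thesis
    proof (cases "fst p = fst q")
      case True
      then show ?thesis using ch bc by simp
    next
      case False
      have r: "0 \<le> t" "fst q \<le> X" using path_le[OF pq(2)] t by auto
      have p: "snd p = f (fst p)" using False ch r pq(1) by (cases p) (auto simp: mem_path)
      have le: "?\<phi> q \<le> fst q + b * f (fst q)" using path_le[OF pq(2)] bc by simp
      let ?d = "fst q - t"
      have "?d * (fst q + b * f (fst q)) \<le> (fst q - fst p) * (t + b * f t) + (fst p - t) * (fst q + b * f (fst q))"
        using mult_left_mono[OF max[of "fst q"], of "fst q - fst p"] r ch by (simp add: algebra_simps)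
      also have "\<dots> = ?d * fst p + b * ((fst q - fst p) * f t + (fst p - t) * f (fst q))"
        by (simp add: algebra_simps)
      also have "\<dots> \<le> ?d * fst p + b * (?d * f (fst p))"
        using chord[of t "fst p" "fst q"] r ch False bc by (intro add_left_mono mult_left_mono) auto
      also have "\<dots> = ?d * ?\<phi> p" using p by (simp add: algebra_simps)
      finally have "?d * (fst q + b * f (fst q)) \<le> ?d * ?\<phi> p" .
      then show ?thesis using ch False le by simp
    qed
  qed
  \<comment> \<open>The edge \<open>(s, - t)\<close> contributes \<open>c * s\<close> before the maximizer \<open>w\<close> and \<open>c * b * t\<close> after it.\<close>
  define F where "F = (\<lambda>p. if ?\<sigma> p \<le> ?\<sigma> w then fst p else fst w + b * (snd w - snd p))"
  have edge: "det2 (q - p) (SOME r. on_tangent (ellipsoid_region (b * c) c) (q - p) r) = c * F q - c * F p"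
    if "(p, q) \<in> path_edges path" for p q
  proof -
    \<comment> \<open>As \<open>w\<close> is a vertex, no edge passes across it.\<close>
    have pq: "p \<in> path" "q \<in> path" "?\<sigma> p < ?\<sigma> q" "\<not> (?\<sigma> p < ?\<sigma> w \<and> ?\<sigma> w < ?\<sigma> q)"
      using that w vertices_subset unfolding edges_eq by auto
    have ch: "fst p \<le> fst q" "snd q \<le> snd p" using chain[OF pq(1,2)] pq by auto
    have "max (fst q - fst p) (b * (snd p - snd q)) = F q - F p"
    proof (cases "?\<sigma> q \<le> ?\<sigma> w")
      case True
      then show ?thesis using before[OF pq(1-3) True] pq by (simp add: F_def algebra_simps)
    next
      case False
      then have pw: "?\<sigma> w \<le> ?\<sigma> p" using pq by linarith
      have "?\<sigma> p \<le> ?\<sigma> w \<Longrightarrow> p = w" using chain_inj[OF pq(1) w(2)] pw by simp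
      then show ?thesis using after[OF pq(1-3) pw] False by (auto simp: F_def algebra_simps)
    qed
    moreover have "q - p = (fst q - fst p, - (snd p - snd q))" by (simp add: prod_eq_iff)
    ultimately show ?thesis
      using det2_some_tangent[of "q - p" "fst q - fst p" "snd p - snd q" b c] ch bc
      by (simp add: right_diff_distrib)
  qed
  have action: "action (ellipsoid_region (b * c) c) \<Lambda> = c * (fst w + b * snd w)" if "gen_path \<Lambda> = path" for \<Lambda>
  proof -
    have "action (ellipsoid_region (b * c) c) \<Lambda> = (\<Sum>(p, q)\<in>path_edges path. c * F q - c * F p)"
      unfolding action_def that by (intro sum.cong refl) (use edge in auto)
    also have "\<dots> = c * F (X, 0) - c * F (0, f 0)"
      unfolding edges_eq
    proof (rule sum_chain)
      show "finite ?V" by (rule vertices_finite[OF int])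
      show "inj_on ?\<sigma> ?V"
        by (intro inj_onI chain_inj) (use vertices_subset in auto)
      fix r assume "r \<in> ?V"
      then have "r \<in> path" using vertices_subset by auto
      then show "?\<sigma> (0, f 0) \<le> ?\<sigma> r \<and> ?\<sigma> r \<le> ?\<sigma> (X, 0)"
        using path_le[of r] snd_nonneg[of r] f_le_start[of "fst r"] by force
    qed (rule ends_vertices)+
    also have "F (0, f 0) = 0" using t f_le_start[of t] by (auto simp: F_def w_def)
    also have "F (X, 0) = fst w + b * snd w"
    proof -
      \<comment> \<open>If \<open>(X, 0)\<close> does not come after \<open>w\<close>, it equals
        \<open>w\<close>, and then \<open>snd w = 0\<close>.\<close>
      have "X \<le> t - f t \<Longrightarrow> X = t \<and> f t = 0" using t f_nonneg[of t] by auto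
      then show ?thesis by (auto simp: F_def w_def)
    qed
    finally show ?thesis by simp
  qed
  show thesis using that[OF w(1) \<phi>_le action] by blast
qed

section \<open>Determination of a path by its lattice points\<close>

text \<open>Since \<open>- g\<close> is convex, \<open>f - g\<close> is maximal at a vertex of the
  path of \<open>f\<close>. That vertex is an enclosed lattice point, so \<open>f - g\<close> is at
  most 0 there, hence everywhere.\<close>

lemma height_le:
  assumes g: "convex_graph X g" and int: "path_vertices path \<subseteq> lattice_points"
    and encl: "enclosed_lattice_points path \<subseteq> enclosed_lattice_points (convex_graph.path X g)"
    and s: "0 \<le> s" "s \<le> X"
  shows "f s \<le> g s"
proof -
  interpret g: convex_graph X g by fact
  have "convex_on {0..X} (\<lambda>s. - g s)" using g.conc by (simp add: concave_on_def)
  then obtain t where t: "t \<in> {0..X}" "(t, f t) \<in> path_vertices path"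
    "\<And>s. s \<in> {0..X} \<Longrightarrow> f s + - g s \<le> f t + - g t"
    using exists_maximal_vertex by blast
  have "(t, f t) \<in> enclosed_lattice_points path"
    using t int vertex_enclosed by (auto simp: enclosed_lattice_points_def)
  then have "f t \<le> g t" using encl by (auto simp: enclosed_lattice_points_def g.mem_enclosed)
  then show ?thesis using t(3)[of s] s by simp
qed

end

text \<open>The lower right end points force equal widths; comparing heights in both directions then
  identifies the graphs.\<close>

lemma enclosed_lattice_points_inj:
  assumes P: "convex_integral_path P" and Q: "convex_integral_path Q"
    and eq: "enclosed_lattice_points P = enclosed_lattice_points Q"
  shows "P = Q"
proof -
  obtain X f where f: "convex_graph X f" and Pf: "P = convex_graph.path X f"
    using P convex_path_graph by (auto simp: convex_integral_path_def)
  obtain X' g where g: "convex_graph X' g" and Qg: "Q = convex_graph.path X' g"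
    using Q convex_path_graph by (auto simp: convex_integral_path_def)
  interpret f: convex_graph X f by fact
  interpret g: convex_graph X' g by fact
  have "(X, 0) \<in> enclosed_lattice_points P" "(X', 0) \<in> enclosed_lattice_points Q"
    using P Q f.ends_vertices g.ends_vertices f.vertex_enclosed g.vertex_enclosed
    unfolding Pf Qg convex_integral_path_def enclosed_lattice_points_def by auto
  then have "(X, 0) \<in> enclosed_region g.path" "(X', 0) \<in> enclosed_region f.path"
    using eq unfolding Pf Qg enclosed_lattice_points_def by blast+
  then have X: "X' = X"
    unfolding f.mem_enclosed g.mem_enclosed by linarith
  note g' = g[unfolded X]
  have Q': "path_vertices (convex_graph.path X g) \<subseteq> lattice_points" "path_vertices f.path \<subseteq> lattice_points"
    using P Q unfolding Pf Qg X convex_integral_path_def by auto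
  have e: "enclosed_lattice_points f.path = enclosed_lattice_points (convex_graph.path X g)"
    using eq unfolding Pf Qg X .
  have fg: "f s = g s" if "0 \<le> s" "s \<le> X" for s
  proof (rule antisym)
    show "f s \<le> g s" by (rule f.height_le[OF g' Q'(2) _ that]) (simp add: e)
    show "g s \<le> f s" by (rule convex_graph.height_le[OF g' f Q'(1) _ that]) (simp add: e)
  qed
  have "(\<lambda>t. (t, f t)) ` {0..X} = (\<lambda>t. (t, g t)) ` {0..X}"
    by (rule image_cong) (simp_all add: fg)
  then show ?thesis
    unfolding Pf Qg X f.path_def convex_graph.path_def[OF g'] using fg[of X] f.X_nonneg by simp
qed

section \<open>Convex integral paths with prescribed lattice points\<close>

text \<open>\<open>g\<close> is the pointwise infimum of all concave majorants. Where it exceeds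
  \<open>h\<close> and is strictly concave it could be lowered, so kinks occur only at points of
  contact with \<open>h\<close>.\<close>

lemma least_concave_majorant:
  fixes h :: "nat \<Rightarrow> real" and N :: nat
  obtains g where "\<And>k. k \<le> N \<Longrightarrow> h k \<le> g k"
    "\<And>k. Suc (Suc k) \<le> N \<Longrightarrow> g k + g (Suc (Suc k)) \<le> 2 * g (Suc k)"
    "\<And>u k. (\<And>k. k \<le> N \<Longrightarrow> h k \<le> u k) \<Longrightarrow>
        (\<And>k. Suc (Suc k) \<le> N \<Longrightarrow> u k + u (Suc (Suc k)) \<le> 2 * u (Suc k)) \<Longrightarrow> k \<le> N \<Longrightarrow> g k \<le> u k"
    "h 0 = g 0" "h N = g N"
    "\<And>k. Suc (Suc k) \<le> N \<Longrightarrow> h (Suc k) \<noteq> g (Suc k) \<Longrightarrow> g k + g (Suc (Suc k)) = 2 * g (Suc k)"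
proof -
  define U where "U = {u :: nat \<Rightarrow> real. (\<forall>k\<le>N. h k \<le> u k) \<and>
    (\<forall>k. Suc (Suc k) \<le> N \<longrightarrow> u k + u (Suc (Suc k)) \<le> 2 * u (Suc k))}"
  define g where "g k = (INF u\<in>U. u k)" for k
  have bdd: "bdd_below ((\<lambda>u. u k) ` U)" if "k \<le> N" for k
    using that by (intro bdd_belowI[of _ "h k"]) (auto simp: U_def)
  have "(\<lambda>_. Max (h ` {..N})) \<in> U" by (auto simp: U_def)
  then have ne: "U \<noteq> {}" by blast
  have g_le: "g k \<le> u k" if "u \<in> U" "k \<le> N" for u k
    unfolding g_def using bdd that by (intro cINF_lower)
  have h_le: "h k \<le> g k" if "k \<le> N" for k
    unfolding g_def using ne that by (intro cINF_greatest) (auto simp: U_def)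
  have conc: "g k + g (Suc (Suc k)) \<le> 2 * g (Suc k)" if k: "Suc (Suc k) \<le> N" for k
  proof -
    have "(g k + g (Suc (Suc k))) / 2 \<le> g (Suc k)"
      unfolding g_def[of "Suc k"]
    proof (rule cINF_greatest[OF ne])
      fix u assume u: "u \<in> U"
      then have "u k + u (Suc (Suc k)) \<le> 2 * u (Suc k)" using k by (simp add: U_def)
      then show "(g k + g (Suc (Suc k))) / 2 \<le> u (Suc k)"
        using g_le[OF u, of k] g_le[OF u, of "Suc (Suc k)"] k by simp
    qed
    then show ?thesis by simp
  qed
  \<comment> \<open>Lowering one value of \<open>g\<close> preserves concavity at the neighbouring indices.\<close>
  have lower: "g k \<le> a"
    if k: "k \<le> N" and a: "h k \<le> a" "a \<le> g k"
      and mid: "\<And>j. k = Suc j \<Longrightarrow> Suc (Suc j) \<le> N \<Longrightarrow> g j + g (Suc (Suc j)) \<le> 2 * a" for k a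
  proof -
    have "g(k := a) \<in> U"
      unfolding U_def
    proof (intro CollectI conjI allI impI)
      fix j assume j: "Suc (Suc j) \<le> N"
      show "(g(k := a)) j + (g(k := a)) (Suc (Suc j)) \<le> 2 * (g(k := a)) (Suc j)"
      proof (cases "k = Suc j")
        case True
        then show ?thesis using mid j by simp
      next
        case False
        have "(g(k := a)) i \<le> g i" for i using a by simp
        then have "(g(k := a)) j + (g(k := a)) (Suc (Suc j)) \<le> g j + g (Suc (Suc j))"
          by (intro add_mono)
        also have "\<dots> \<le> 2 * (g(k := a)) (Suc j)" using conc[OF j] False by simp
        finally show ?thesis .
      qed
    qed (use a h_le in auto)
    from g_le[OF this k] show ?thesis by simp
  qed
  \<comment> \<open>No second difference is centred at \<open>0\<close> or \<open>N\<close>, so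
    there \<open>g\<close> can be lowered all the way to \<open>h\<close>.\<close>
  have ends: "h k = g k" if "k = 0 \<or> k = N" for k
    using lower[of k "h k"] h_le[of k] that by auto
  have contact: "g k + g (Suc (Suc k)) = 2 * g (Suc k)"
    if k: "Suc (Suc k) \<le> N" and "h (Suc k) \<noteq> g (Suc k)" for k
  proof -
    \<comment> \<open>\<open>?a\<close> is the least value at \<open>Suc k\<close> that is not below
      \<open>h\<close> and keeps the second difference centred there nonpositive.\<close>
    let ?a = "max (h (Suc k)) ((g k + g (Suc (Suc k))) / 2)"
    have "h (Suc k) < g (Suc k)" using that h_le[of "Suc k"] by simp
    moreover have "g (Suc k) \<le> ?a"
      using k h_le[of "Suc k"] conc[OF k] by (intro lower) (auto simp: max_def)
    ultimately show ?thesis using conc[OF k] by (simp add: max_def split: if_splits)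
  qed
  show thesis
  proof (rule that[OF h_le conc])
    fix u :: "nat \<Rightarrow> real" and k
    assume "\<And>k. k \<le> N \<Longrightarrow> h k \<le> u k"
      "\<And>k. Suc (Suc k) \<le> N \<Longrightarrow> u k + u (Suc (Suc k)) \<le> 2 * u (Suc k)" "k \<le> N"
    then show "g k \<le> u k" by (intro g_le) (auto simp: U_def)
  qed (use ends contact in auto)
qed

text \<open>Written through second differences, so that concavity is visible termwise. It interpolates
  \<open>g\<close> only at \<open>0, \<dots>, N\<close>.\<close>

definition interpolation :: "nat \<Rightarrow> (nat \<Rightarrow> real) \<Rightarrow> real \<Rightarrow> real" where
  "interpolation N g t = g 0 + (g 1 - g 0) * t
     - (\<Sum>k = 1..<N. (2 * g k - g (k - 1) - g (k + 1)) * max 0 (t - real k))"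

text \<open>The increment from \<open>n\<close> to \<open>Suc n\<close> is the initial slope minus
  the second-difference coefficients at \<open>1, \<dots>, n\<close>, which telescope. These indices
  are all below \<open>N\<close> because \<open>Suc n \<le> N\<close>.\<close>

lemma interpolation_nat:
  assumes "n \<le> N"
  shows "interpolation N g (real n) = g n"
  using assms
proof (induction n)
  case 0
  have "(\<Sum>k = 1..<N. (2 * g k - g (k - 1) - g (k + 1)) * max 0 (real 0 - real k)) = 0"
    by (intro sum.neutral) auto
  then show ?case by (simp add: interpolation_def)
next
  case (Suc n)
  let ?e = "\<lambda>k. 2 * g k - g (k - 1) - g (k + 1)"
  have max: "max 0 (real (Suc n) - real k) = (if k \<le> n then real (Suc n) - real k else 0)"
    "max 0 (real n - real k) = (if k \<le> n then real n - real k else 0)" for k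
    by (auto simp: max_def)
  have "interpolation N g (real n) - interpolation N g (real (Suc n))
    = (g 0 - g 1) + (\<Sum>k = 1..<N. ?e k * max 0 (real (Suc n) - real k) - ?e k * max 0 (real n - real k))"
  proof -
    have "(g 1 - g 0) * real (Suc n) = (g 1 - g 0) * real n + (g 1 - g 0)" by (simp add: algebra_simps)
    then show ?thesis unfolding interpolation_def sum_subtractf by linarith
  qed
  also have "(\<Sum>k = 1..<N. ?e k * max 0 (real (Suc n) - real k) - ?e k * max 0 (real n - real k))
      = (\<Sum>k = 1..<Suc n. ?e k)"
    using Suc.prems by (intro sum.mono_neutral_cong_right) (auto simp: max algebra_simps)
  also have "(\<Sum>k = 1..<Suc n. ?e k) = g 1 - g 0 - (g (Suc n) - g n)"
    by (induction n) auto
  finally show ?case using Suc by simp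
qed

text \<open>On \<open>{a..b}\<close> the hinge at \<open>k\<close> is linear if
  \<open>k \<le> a\<close> and zero if \<open>k \<ge> b\<close>; in between its coefficient
  vanishes.\<close>

lemma interpolation_affine:
  assumes "\<And>k. 1 \<le> k \<Longrightarrow> k < N \<Longrightarrow> a < real k \<Longrightarrow> real k < b \<Longrightarrow> 2 * g k = g (k - 1) + g (k + 1)"
  shows "\<exists>m c. \<forall>t\<in>{a..b}. interpolation N g t = m * t + c"
proof -
  let ?e = "\<lambda>k. 2 * g k - g (k - 1) - g (k + 1)"
  let ?m = "g 1 - g 0 - (\<Sum>k = 1..<N. if real k \<le> a then ?e k else 0)"
  let ?c = "g 0 + (\<Sum>k = 1..<N. if real k \<le> a then ?e k * real k else 0)"
  have "interpolation N g t = ?m * t + ?c" if t: "t \<in> {a..b}" for t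
  proof -
    have "(\<Sum>k = 1..<N. ?e k * max 0 (t - real k))
      = (\<Sum>k = 1..<N. (if real k \<le> a then ?e k else 0) * t - (if real k \<le> a then ?e k * real k else 0))"
    proof (intro sum.cong refl)
      fix k assume k: "k \<in> {1..<N}"
      consider "real k \<le> a" | "b \<le> real k" "a < real k" | "?e k = 0"
        using assms[of k] k by force
      then show "?e k * max 0 (t - real k)
          = (if real k \<le> a then ?e k else 0) * t - (if real k \<le> a then ?e k * real k else 0)"
      proof cases
        case 2
        then have "max 0 (t - real k) = 0" using t by auto
        then show ?thesis using 2 by simp
      qed (use t in \<open>auto simp: max_def algebra_simps\<close>)
    qed
    also have "\<dots> = (\<Sum>k = 1..<N. if real k \<le> a then ?e k else 0) * t
        - (\<Sum>k = 1..<N. if real k \<le> a then ?e k * real k else 0)"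
      by (simp only: sum_subtractf sum_distrib_right)
    finally show ?thesis by (simp add: interpolation_def algebra_simps)
  qed
  then show ?thesis by blast
qed

lemma piecewise_linear_interpolation: "piecewise_linear a b (interpolation N g)"
  unfolding piecewise_linear_def
proof (intro exI[of _ "real ` {1..<N}"] conjI allI impI)
  fix s t :: real
  assume "a \<le> s \<and> s < t \<and> t \<le> b \<and> {s<..<t} \<inter> real ` {1..<N} = {}"
  then have "\<not> (s < real k \<and> real k < t)" if "1 \<le> k" "k < N" for k
    using that by (auto simp: disjoint_iff)
  then show "\<exists>m k. \<forall>u\<in>{s..t}. interpolation N g u = m * u + k"
    by (intro interpolation_affine) blast
qed simp

lemma concave_interpolation:
  assumes "\<And>k. Suc (Suc k) \<le> N \<Longrightarrow> g k + g (Suc (Suc k)) \<le> 2 * g (Suc k)"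
  shows "concave_on {a..b} (interpolation N g)"
  unfolding concave_on_def
proof (intro convex_onI)
  let ?e = "\<lambda>k. 2 * g k - g (k - 1) - g (k + 1)"
  fix l x y :: real assume l: "0 < l" "l < 1"
  let ?z = "(1 - l) *\<^sub>R x + l *\<^sub>R y"
  have "(\<Sum>k = 1..<N. ?e k * max 0 (?z - real k))
    \<le> (\<Sum>k = 1..<N. (1 - l) * (?e k * max 0 (x - real k)) + l * (?e k * max 0 (y - real k)))"
  proof (rule sum_mono)
    fix k assume k: "k \<in> {1..<N}"
    have e: "0 \<le> ?e k" using assms[of "k - 1"] k by simp
    have "?z - real k = (1 - l) * (x - real k) + l * (y - real k)" by (simp add: algebra_simps)
    also have "\<dots> \<le> (1 - l) * max 0 (x - real k) + l * max 0 (y - real k)"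
      using l by (intro add_mono mult_left_mono) auto
    finally have "max 0 (?z - real k) \<le> (1 - l) * max 0 (x - real k) + l * max 0 (y - real k)"
      using l by simp
    then have "?e k * max 0 (?z - real k) \<le> ?e k * ((1 - l) * max 0 (x - real k) + l * max 0 (y - real k))"
      using e by (intro mult_left_mono)
    then show "?e k * max 0 (?z - real k) \<le> (1 - l) * (?e k * max 0 (x - real k)) + l * (?e k * max 0 (y - real k))"
      by (simp add: algebra_simps)
  qed
  also have "\<dots> = (1 - l) * (\<Sum>k = 1..<N. ?e k * max 0 (x - real k)) + l * (\<Sum>k = 1..<N. ?e k * max 0 (y - real k))"
    by (simp only: sum.distrib sum_distrib_left)
  finally show "- interpolation N g ?z \<le> (1 - l) * - interpolation N g x + l * - interpolation N g y"
    by (simp add: interpolation_def algebra_simps)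
qed simp

text \<open>Near any other point the path is contained in a line, either the vertical one or that of
  an affine piece. \<open>D\<close> collects the abscissae at which a kink is permitted.\<close>

lemma (in convex_graph) vertices_subset_breaks:
  assumes "\<And>t. 0 < t \<Longrightarrow> t < X \<Longrightarrow> t \<notin> D \<Longrightarrow>
      \<exists>a b m k. 0 \<le> a \<and> a < t \<and> t < b \<and> b \<le> X \<and> (\<forall>s\<in>{a..b}. f s = m * s + k)"
  shows "path_vertices path \<subseteq> {(0, f 0), (X, 0), (X, f X)} \<union> (\<lambda>t. (t, f t)) ` D"
proof
  fix p assume "p \<in> path_vertices path"
  then consider "p = (0, f 0)" | "p = (X, 0)"
    | "p \<in> path" "\<And>\<epsilon>. \<epsilon> > 0 \<Longrightarrow> \<not> collinear (path \<inter> ball p \<epsilon>)"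
    by (auto simp: path_vertices_def x_end y_end)
  then show "p \<in> {(0, f 0), (X, 0), (X, f X)} \<union> (\<lambda>t. (t, f t)) ` D"
  proof cases
    case 3
    obtain x y where p: "p = (x, y)" by force
    then have xy: "0 \<le> x" "x \<le> X" "y = f x \<or> x = X \<and> y \<le> f X" using 3(1) by (auto simp: mem_path)
    show ?thesis
    proof (rule ccontr)
      assume contra: "\<not> ?thesis"
      then consider "x = X" "y < f X" | "0 < x" "x < X" "x \<notin> D" "y = f x"
        using xy unfolding p by force
      then show False
      proof cases
        case 1
        \<comment> \<open>A ball of this radius stays below height \<open>f X\<close>, while the
          graph to the left of \<open>X\<close> never goes below that height.\<close>
        have "path \<inter> ball p (f X - y) \<subseteq> {X} \<times> UNIV"
        proof
          fix q assume q: "q \<in> path \<inter> ball p (f X - y)"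
          then have "dist y (snd q) < f X - y"
            using dist_snd_le[of p q] p by auto
          then have "snd q < f X" by (simp add: dist_real_def)
          moreover have "q \<in> path" using q by simp
          ultimately show "q \<in> {X} \<times> UNIV"
            using antimono[of "fst q" X] by (cases q) (auto simp: mem_path)
        qed
        then have "collinear (path \<inter> ball p (f X - y))"
          using collinear_vertical collinear_subset by blast
        then show False using 3(2) 1 by simp
      next
        case 2
        obtain a b m k where ab: "0 \<le> a" "a < x" "x < b" "b \<le> X" "\<And>s. s \<in> {a..b} \<Longrightarrow> f s = m * s + k"
          using assms[OF 2(1-3)] by blast
        let ?e = "min (x - a) (b - x)"
        have "path \<inter> ball p ?e \<subseteq> {(x, y). y = m * x + k}"
        proof
          fix q assume q: "q \<in> path \<inter> ball p ?e"
          then have "dist x (fst q) < ?e"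
            using dist_fst_le[of p q] p by auto
          then have "a < fst q" "fst q < b" by (auto simp: dist_real_def)
          moreover have "q \<in> path" using q by simp
          ultimately show "q \<in> {(x, y). y = m * x + k}"
            using ab by (cases q) (auto simp: mem_path)
        qed
        then have "collinear (path \<inter> ball p ?e)"
          using collinear_graph collinear_subset by blast
        then show False using 3(2) ab by simp
      qed
    qed
  qed auto
qed

text \<open>The path is the graph of the least concave majorant of the column heights of
  \<open>S\<close>, closed off by a vertical segment. A separating line is itself a concave
  majorant, so no lattice point outside \<open>S\<close> is enclosed.\<close>

lemma lattice_hull:
  fixes S :: "plane set"
  assumes fin: "finite S" and ne: "S \<noteq> {}" and sub: "S \<subseteq> quadrant \<inter> lattice_points"
    and sep: "\<And>p. p \<in> quadrant \<inter> lattice_points - S \<Longrightarrow> \<exists>\<alpha> \<beta> \<tau>. 0 \<le> \<alpha> \<and> 0 < \<beta>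
        \<and> (\<forall>s\<in>S. \<alpha> * fst s + \<beta> * snd s \<le> \<tau>) \<and> \<tau> < \<alpha> * fst p + \<beta> * snd p"
  obtains P where "convex_integral_path P" "enclosed_lattice_points P = S"
proof -
  have S: "0 \<le> x" "0 \<le> y" "x \<in> \<int>" "y \<in> \<int>" if "(x, y) \<in> S" for x y
    using that sub by (auto simp: quadrant_def lattice_points_def)
  \<comment> \<open>A separating functional has nonnegative coefficients, so it cannot grow under
    moves to the left or down.\<close>
  have down: "(x', y') \<in> S"
    if xy: "(x, y) \<in> S" "0 \<le> x'" "x' \<le> x" "0 \<le> y'" "y' \<le> y" "x' \<in> \<int>" "y' \<in> \<int>" for x y x' y'
  proof (rule ccontr)
    assume "(x', y') \<notin> S"
    then obtain \<alpha> \<beta> \<tau> where *: "0 \<le> \<alpha>" "0 < \<beta>" "\<And>s. s \<in> S \<Longrightarrow> \<alpha> * fst s + \<beta> * snd s \<le> \<tau>"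
      "\<tau> < \<alpha> * x' + \<beta> * y'"
      using sep[of "(x', y')"] xy by (auto simp: quadrant_def lattice_points_def)
    have "\<alpha> * x' + \<beta> * y' \<le> \<alpha> * x + \<beta> * y"
      using * xy by (intro add_mono mult_left_mono) auto
    then show False using *(3)[OF xy(1)] *(4) by simp
  qed
  have "Max (fst ` S) \<in> fst ` S" using fin ne by simp
  then obtain y0 where y0: "(Max (fst ` S), y0) \<in> S" by force
  obtain N where N: "real N = Max (fst ` S)"
    using S(1,3)[OF y0] Nats_altdef2[where 'a = real] by (metis (mono_tags, lifting) Nats_cases mem_Collect_eq)
  have le_N: "x \<le> real N" if "(x, y) \<in> S" for x y
    unfolding N using that fin by (force intro!: Max_ge)
  have col_fin: "finite {y. (x, y) \<in> S}" for x
    by (rule finite_subset[OF _ finite_imageI[OF fin, of snd]]) force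
  have bottom: "(real k, 0) \<in> S" if "k \<le> N" for k
    by (rule down[OF y0]) (use that S[OF y0] N in auto)
  define h where "h k = Max {y. (real k, y) \<in> S}" for k
  have h_in: "(real k, h k) \<in> S" if "k \<le> N" for k
    using Max_in[OF col_fin[of "real k"]] bottom[OF that] unfolding h_def by blast
  have h_ge: "y \<le> h k" if "(real k, y) \<in> S" for k y
    unfolding h_def using that col_fin by (intro Max_ge) auto
  obtain g where g: "\<And>k. k \<le> N \<Longrightarrow> h k \<le> g k"
    "\<And>k. Suc (Suc k) \<le> N \<Longrightarrow> g k + g (Suc (Suc k)) \<le> 2 * g (Suc k)"
    "\<And>u k. (\<And>k. k \<le> N \<Longrightarrow> h k \<le> u k) \<Longrightarrow>
        (\<And>k. Suc (Suc k) \<le> N \<Longrightarrow> u k + u (Suc (Suc k)) \<le> 2 * u (Suc k)) \<Longrightarrow> k \<le> N \<Longrightarrow> g k \<le> u k"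
    "h 0 = g 0" "h N = g N"
    "\<And>k. Suc (Suc k) \<le> N \<Longrightarrow> h (Suc k) \<noteq> g (Suc k) \<Longrightarrow> g k + g (Suc (Suc k)) = 2 * g (Suc k)"
    using least_concave_majorant[of N h] by blast
  define f where "f = interpolation N g"
  have fg: "f (real k) = g k" if "k \<le> N" for k
    unfolding f_def using that by (rule interpolation_nat)
  have f0: "f 0 = g 0" using fg[of 0] by simp
  have g_le_0: "g k \<le> g 0" if "k \<le> N" for k
  \<comment> \<open>No column of \<open>S\<close> is higher than the one over 0, so the constant
    \<open>g 0\<close> is a concave majorant.\<close>
  proof (rule g(3)[OF _ _ that])
    fix k assume "k \<le> N"
    then have "(0, h k) \<in> S" using down[OF h_in] S[OF h_in] by simp
    then show "h k \<le> g 0" using h_ge[of 0 "h k"] g(1)[of 0] by simp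
  qed simp
  have g_nonneg: "0 \<le> g k" if "k \<le> N" for k
    using S(2)[OF h_in[OF that]] g(1)[OF that] by simp
  have conc: "concave_on {0..real N} f" unfolding f_def using g(2) by (rule concave_interpolation)
  have f_nonneg: "0 \<le> f t" if t: "0 \<le> t" "t \<le> real N" for t
  proof (cases "N = 0")
    case True then show ?thesis using t f0 g_nonneg by simp
  next
    case False
    have "convex_on {0..real N} (\<lambda>t. - f t)" using conc by (simp add: concave_on_def)
    then have "(real N - t) * f 0 + t * f (real N) \<le> real N * f t"
      using convex_on_chord[of 0 "real N" "\<lambda>t. - f t" t] t False by simp
    moreover have "0 \<le> (real N - t) * f 0 + t * f (real N)"
      using t fg[of N] f0 g_nonneg by simp
    ultimately have "0 \<le> real N * f t" by linarith
    then show ?thesis using False by (simp add: zero_le_mult_iff)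
  qed
  have f_le: "f t \<le> f 0" if t: "0 \<le> t" "t \<le> real N" for t
  proof (cases "N = 0")
    case True then show ?thesis using t by simp
  next
    case False
    have "0 \<le> (\<Sum>k = 1..<N. (2 * g k - g (k - 1) - g (k + 1)) * max 0 (t - real k))"
    proof (intro sum_nonneg mult_nonneg_nonneg)
      fix k assume "k \<in> {1..<N}"
      then show "0 \<le> 2 * g k - g (k - 1) - g (k + 1)" using g(2)[of "k - 1"] by simp
    qed simp
    moreover have "(g 1 - g 0) * t \<le> 0"
      using g_le_0[of 1] False t by (intro mult_nonpos_nonneg) auto
    ultimately show ?thesis unfolding f0 by (simp add: f_def interpolation_def)
  qed
  have graph: "convex_graph (real N) f"
    using f_nonneg f_le conc piecewise_linear_interpolation[of 0 "real N" N g]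
    by unfold_locales (simp_all add: f_def)
  interpret convex_graph "real N" f by (fact graph)
  have "\<exists>D\<le>0. (f has_real_derivative D) (at 0 within {0..real N})" if "0 < real N"
  proof -
    \<comment> \<open>The first possible kink is at 1, so the derivative at 0 is the slope of the
      first piece, nonpositive because \<open>f 1 \<le> f 0\<close>.\<close>
    have "\<exists>m c. \<forall>t\<in>{0..1}. interpolation N g t = m * t + c"
      by (rule interpolation_affine) auto
    then obtain m c where mc: "\<And>t. t \<in> {0..1} \<Longrightarrow> f t = m * t + c" unfolding f_def by blast
    have "m \<le> 0" using mc[of 0] mc[of 1] f_le[of 1] that by simp
    moreover have "((\<lambda>t. m * t + c) has_real_derivative m) (at 0 within {0..real N})"
      by (auto intro!: derivative_eq_intros)
    then have "(f has_real_derivative m) (at 0 within {0..real N})"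
      by (rule has_field_derivative_transform_within[where d = 1]) (auto simp: mc dist_real_def)
    ultimately show ?thesis by blast
  qed
  then have cp: "convex_path path"
    unfolding convex_path_def path_def
    using pl conc X_nonneg f_nonneg f_le f0 g_nonneg[of 0]
    by (intro exI[of _ "real N"] exI[of _ "g 0"] exI[of _ f]) auto
  have lattice: "(real k, g k) \<in> lattice_points" if "k \<le> N" "h k = g k" for k
    using h_in[OF that(1)] that sub by auto
  let ?D = "real ` {k. k \<le> N \<and> h k = g k}"
  have "path_vertices path \<subseteq> {(0, f 0), (real N, 0), (real N, f (real N))} \<union> (\<lambda>t. (t, f t)) ` ?D"
  proof (rule vertices_subset_breaks)
    fix t assume t: "0 < t" "t < real N" "t \<notin> ?D"
    \<comment> \<open>\<open>j\<close> is the largest integer strictly below \<open>t\<close>, so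
      \<open>t\<close> may coincide with \<open>Suc j\<close>.\<close>
    define j where "j = nat (\<lceil>t\<rceil> - 1)"
    have j: "real j < t" "t \<le> real (Suc j)" "Suc j \<le> N"
      using t unfolding j_def by linarith+
    \<comment> \<open>If \<open>t\<close> is the integer \<open>Suc j\<close>, the interval is
      extended by one column so that \<open>t\<close> is interior; \<open>t \<notin> ?D\<close>
      excludes a kink there.\<close>
    define b where "b = (if t = real (Suc j) then Suc (Suc j) else Suc j)"
    have b: "t < real b" "b \<le> N" using j t by (auto simp: b_def)
    have "\<exists>m c. \<forall>s\<in>{real j..real b}. interpolation N g s = m * s + c"
    proof (rule interpolation_affine)
      fix k assume k: "real j < real k" "real k < real b"
      then have kj: "k = Suc j" "t = real (Suc j)" by (auto simp: b_def split: if_splits)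
      have "h k \<noteq> g k"
      proof
        assume "h k = g k"
        then have "real k \<in> ?D" using kj j by blast
        then show False using t kj by simp
      qed
      then show "2 * g k = g (k - 1) + g (k + 1)"
        using g(6)[of j] kj t j by simp
    qed
    then obtain m c where "\<forall>s\<in>{real j..real b}. f s = m * s + c" unfolding f_def by blast
    then show "\<exists>a b m k. 0 \<le> a \<and> a < t \<and> t < b \<and> b \<le> real N \<and> (\<forall>s\<in>{a..b}. f s = m * s + k)"
      using j b by (intro exI[of _ "real j"] exI[of _ "real b"] exI[of _ m] exI[of _ c]) simp
  qed
  also have "\<dots> \<subseteq> lattice_points"
    using lattice[of 0] lattice[of N] lattice g(4,5) fg f0 by (auto simp: lattice_points_def)
  finally have vert: "path_vertices path \<subseteq> lattice_points" .
  then have integral: "convex_integral_path path"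
    using cp ends_vertices by (auto simp: convex_integral_path_def x_end y_end lattice_points_def)
  have "enclosed_lattice_points path = S"
  proof (intro equalityI subsetI)
    fix p assume "p \<in> enclosed_lattice_points path"
    then obtain x y where p: "p = (x, y)" "0 \<le> x" "x \<le> real N" "0 \<le> y" "y \<le> f x" "x \<in> \<int>" "y \<in> \<int>"
      by (cases p) (auto simp: enclosed_lattice_points_def mem_enclosed lattice_points_def)
    then obtain k where k: "x = real k"
      by (metis Nats_altdef2 Nats_cases mem_Collect_eq)
    then have kN: "k \<le> N" using p by simp
    show "p \<in> S"
    proof (rule ccontr)
      assume "p \<notin> S"
      then obtain \<alpha> \<beta> \<tau> where *: "0 < \<beta>" "\<And>s. s \<in> S \<Longrightarrow> \<alpha> * fst s + \<beta> * snd s \<le> \<tau>"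
        "\<tau> < \<alpha> * x + \<beta> * y"
        using sep[of p] p by (auto simp: quadrant_def lattice_points_def)
      \<comment> \<open>The separating line, solved for the height, is an affine majorant of
        \<open>h\<close>, so \<open>g\<close> does not exceed it, while \<open>p\<close> lies
        strictly above.\<close>
      have "g k \<le> (\<tau> - \<alpha> * real k) / \<beta>"
      proof (rule g(3)[OF _ _ kN])
        fix i assume "i \<le> N"
        then show "h i \<le> (\<tau> - \<alpha> * real i) / \<beta>"
          using *(1) *(2)[OF h_in] by (simp add: field_simps)
      qed (use *(1) in \<open>simp add: field_simps\<close>)
      then show False using * p(5) fg[OF kN] k by (simp add: field_simps) (smt (verit) mult_left_mono)
    qed
  next
    fix p assume p: "p \<in> S"
    obtain x y where xy: "p = (x, y)" by force
    note Sp = S[OF p[unfolded xy]]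
    obtain k where k: "x = real k"
      using Sp by (metis Nats_altdef2 Nats_cases mem_Collect_eq)
    have kN: "k \<le> N" using le_N p xy k by force
    then have "y \<le> f x" using h_ge[of k y] p xy k g(1)[OF kN] fg[OF kN] by simp
    then show "p \<in> enclosed_lattice_points path"
      using xy Sp kN k by (auto simp: enclosed_lattice_points_def mem_enclosed lattice_points_def)
  qed
  then show thesis using that integral by blast
qed

section \<open>Minimal generators\<close>

lemma initial_segment:
  fixes \<kappa> :: "'a \<Rightarrow> real"
  assumes "finite T" "inj_on \<kappa> T" "n \<le> card T"
  shows "\<exists>S\<subseteq>T. card S = n \<and> (\<forall>s\<in>S. \<forall>q\<in>T - S. \<kappa> s < \<kappa> q)"
  using assms(3)
proof (induction n)
  case 0
  then show ?case by (intro exI[of _ "{}"]) auto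
next
  case (Suc n)
  then obtain S where S: "S \<subseteq> T" "card S = n" "\<forall>s\<in>S. \<forall>q\<in>T - S. \<kappa> s < \<kappa> q" by auto
  have "S \<noteq> T" using S Suc.prems by auto
  then have ne: "finite (T - S)" "T - S \<noteq> {}" using S assms(1) by auto
  define m where "m = arg_min_on \<kappa> (T - S)"
  have m: "m \<in> T - S" "\<And>q. q \<in> T - S \<Longrightarrow> \<kappa> m \<le> \<kappa> q"
    unfolding m_def using arg_min_if_finite(1)[OF ne] arg_min_least[OF ne] by auto
  have "\<kappa> m < \<kappa> q" if "q \<in> T - insert m S" for q
    using m(2)[of q] inj_onD[OF assms(2), of m q] that m(1) by force
  then show ?case
    using S m finite_subset[OF S(1) assms(1)] by (intro exI[of _ "insert m S"]) auto
qed

text \<open>Two points with different abscissae tie for only one weight, so finitely many weights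
  are excluded; points with equal abscissae are separated by \<open>b \<noteq> 0\<close>.\<close>

lemma generic_weight:
  fixes T :: "plane set" and b u v :: real
  assumes "finite T" "b \<noteq> 0" "u < v"
  obtains \<alpha> where "u < \<alpha>" "\<alpha> < v" "inj_on (\<lambda>p. \<alpha> * fst p + b * snd p) T"
proof -
  \<comment> \<open>Pairs with equal abscissae contribute 0, the default value of division by zero,
    which leaves \<open>B\<close> finite.\<close>
  define B where "B = (\<lambda>(p, q). - b * (snd p - snd q) / (fst p - fst q)) ` (T \<times> T)"
  have "infinite ({u<..<v} - B)" using assms by (intro Diff_infinite_finite infinite_Ioo) (auto simp: B_def)
  then obtain \<alpha> where "\<alpha> \<in> {u<..<v} - B" using infinite_imp_nonempty by blast
  then have \<alpha>: "u < \<alpha>" "\<alpha> < v" "\<alpha> \<notin> B" by auto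
  have "inj_on (\<lambda>p. \<alpha> * fst p + b * snd p) T"
  proof (rule inj_onI)
    fix p q assume pq: "p \<in> T" "q \<in> T" "\<alpha> * fst p + b * snd p = \<alpha> * fst q + b * snd q"
    then have eq: "\<alpha> * (fst p - fst q) = - b * (snd p - snd q)" by (simp add: algebra_simps)
    have "fst p = fst q"
    proof (rule ccontr)
      assume "fst p \<noteq> fst q"
      then have "\<alpha> = - b * (snd p - snd q) / (fst p - fst q)" using eq by (simp add: field_simps)
      then have "\<alpha> \<in> B" using pq unfolding B_def by (intro image_eqI[of _ _ "(p, q)"]) auto
      then show False using \<alpha> by simp
    qed
    then show "p = q" using eq assms by (simp add: prod_eq_iff)
  qed
  then show thesis using that \<alpha> by blast
qed

section \<open>Purely elliptic generators: labels, index and action\<close>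

lemma exists_elliptic_generator:
  assumes "convex_integral_path P"
  obtains \<Lambda> where "convex_generator \<Lambda>" "purely_elliptic \<Lambda>" "gen_path \<Lambda> = P"
proof -
  let ?\<Lambda> = "\<lparr>gen_path = P, gen_label = (\<lambda>\<nu>. if \<nu> \<in> path_edges P then Some Label_e else None)\<rparr>"
  have "convex_generator ?\<Lambda>" "purely_elliptic ?\<Lambda>"
    using assms by (auto simp: convex_generator_def purely_elliptic_def dom_def)
  then show thesis using that[of ?\<Lambda>] by simp
qed

lemma elliptic_generator_eqI:
  assumes "convex_generator \<Lambda>" "purely_elliptic \<Lambda>" "convex_generator \<Lambda>'" "purely_elliptic \<Lambda>'"
    and eq: "gen_path \<Lambda> = gen_path \<Lambda>'"
  shows "\<Lambda> = \<Lambda>'"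
proof (rule generator.equality)
  show "gen_label \<Lambda> = gen_label \<Lambda>'"
  proof
    fix \<nu>
    show "gen_label \<Lambda> \<nu> = gen_label \<Lambda>' \<nu>"
    proof (cases "\<nu> \<in> path_edges (gen_path \<Lambda>)")
      case True
      then show ?thesis using assms by (simp add: purely_elliptic_def)
    next
      case False
      then have "\<nu> \<notin> dom (gen_label \<Lambda>)" "\<nu> \<notin> dom (gen_label \<Lambda>')"
        using assms by (simp_all add: convex_generator_def)
      then show ?thesis by (simp add: domIff)
    qed
  qed
qed (use eq in auto)

text \<open>Among purely elliptic generators, equal index therefore means equally many enclosed
  lattice points.\<close>

lemma ech_index_elliptic:
  assumes "purely_elliptic \<Lambda>"
  shows "ech_index \<Lambda> = 2 * (int (card (enclosed_lattice_points (gen_path \<Lambda>))) - 1)"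
proof -
  have "{\<nu> \<in> path_edges (gen_path \<Lambda>). gen_label \<Lambda> \<nu> = Some Label_h} = {}"
    using assms by (auto simp: purely_elliptic_def)
  then have "h_count \<Lambda> = 0" unfolding h_count_def by (simp only: card.empty)
  then show ?thesis by (simp add: ech_index_def lattice_count_def)
qed

lemma generator_action:
  assumes "convex_generator \<Lambda>" and bc: "b > 0" "c > 0"
  obtains w where "w \<in> gen_path \<Lambda>" "w \<in> enclosed_lattice_points (gen_path \<Lambda>)"
    "\<And>p. p \<in> enclosed_region (gen_path \<Lambda>) \<Longrightarrow> fst p + b * snd p \<le> fst w + b * snd w"
    "action (ellipsoid_region (b * c) c) \<Lambda> = c * (fst w + b * snd w)"
    "finite (enclosed_lattice_points (gen_path \<Lambda>))" "gen_path \<Lambda> \<subseteq> enclosed_region (gen_path \<Lambda>)"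
proof -
  have \<Lambda>: "convex_path (gen_path \<Lambda>)" "path_vertices (gen_path \<Lambda>) \<subseteq> lattice_points"
    using assms by (auto simp: convex_generator_def convex_integral_path_def)
  obtain X f where graph: "convex_graph X f" and P: "gen_path \<Lambda> = convex_graph.path X f"
    using convex_path_graph[OF \<Lambda>(1)] .
  interpret convex_graph X f by (fact graph)
  obtain w where w: "w \<in> path_vertices path"
    "\<And>p. p \<in> enclosed_region path \<Longrightarrow> fst p + b * snd p \<le> fst w + b * snd w"
    "action (ellipsoid_region (b * c) c) \<Lambda> = c * (fst w + b * snd w)"
    using action_eq_max[OF \<Lambda>(2)[unfolded P] bc] P by metis
  have "path \<subseteq> enclosed_region path"
  proof
    fix p assume p: "p \<in> path"
    then show "p \<in> enclosed_region path"
      using snd_nonneg[OF p] by (cases p) (auto simp: mem_enclosed mem_path)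
  qed
  moreover have "w \<in> enclosed_lattice_points path"
    using w(1) \<Lambda>(2) vertex_enclosed unfolding P enclosed_lattice_points_def by auto
  ultimately show thesis
    using that[of w] w vertices_subset enclosed_finite unfolding P by blast
qed

theorem proposition1p32:
  fixes b c :: real and \<Lambda> :: generator and \<eta> :: "plane set"
  assumes "b \<ge> 1" and "c > 0"
    and "convex_generator \<Lambda>" and "purely_elliptic \<Lambda>"
    and "tangent_line (- 1 / b) (gen_path \<Lambda>) \<eta>"
  shows "minimal_for (ellipsoid_region (b * c) c) \<Lambda> \<longleftrightarrow>
         maximal_under (gen_path \<Lambda>) (\<eta> \<inter> quadrant)"
proof -
  let ?\<phi> = "\<lambda>p :: plane. fst p + b * snd p"
  let ?A = "action (ellipsoid_region (b * c) c)"
  define E where "E = enclosed_lattice_points (gen_path \<Lambda>)"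
  have bc: "b > 0" "c > 0" using assms by auto
  obtain w where w: "w \<in> gen_path \<Lambda>" "w \<in> E"
    "\<And>p. p \<in> enclosed_region (gen_path \<Lambda>) \<Longrightarrow> ?\<phi> p \<le> ?\<phi> w" "?A \<Lambda> = c * ?\<phi> w" "finite E"
    "gen_path \<Lambda> \<subseteq> enclosed_region (gen_path \<Lambda>)"
    unfolding E_def using generator_action[OF assms(3) bc] by metis
  obtain k where \<eta>: "\<eta> = {(x, y). y = - 1 / b * x + k}"
    and touch: "\<eta> \<inter> gen_path \<Lambda> \<noteq> {}" and below: "\<forall>(x, y)\<in>gen_path \<Lambda>. y \<le> - 1 / b * x + k"
    using assms(5) unfolding tangent_line_def by blast
  have line: "y \<le> - 1 / b * x + k \<longleftrightarrow> x + b * y \<le> b * k" "y = - 1 / b * x + k \<longleftrightarrow> x + b * y = b * k" for x y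
    using bc by (auto simp: field_simps)
  \<comment> \<open>The tangent line is the level line of \<open>x + b y\<close> at its maximum over
    the path.\<close>
  have M: "?\<phi> w = b * k"
  proof (rule antisym)
    show "?\<phi> w \<le> b * k" using below w(1) unfolding line by (cases w) auto
    obtain p where "p \<in> \<eta>" "p \<in> gen_path \<Lambda>" using touch by blast
    then show "b * k \<le> ?\<phi> w" using w(3)[of p] w(6) unfolding \<eta> line by auto
  qed
  define T where "T = {p \<in> quadrant \<inter> lattice_points. ?\<phi> p \<le> ?\<phi> w}"
  have T: "enclosed_lattice_points (\<eta> \<inter> quadrant) = T"
  proof -
    have iff: "(\<exists>v\<ge>y. (x, v) \<in> \<eta> \<inter> quadrant) \<longleftrightarrow> x + b * y \<le> ?\<phi> w" if "0 \<le> x" "0 \<le> y" for x y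
    proof
      assume "x + b * y \<le> ?\<phi> w"
      then have "y \<le> - 1 / b * x + k" unfolding M line .
      then show "\<exists>v\<ge>y. (x, v) \<in> \<eta> \<inter> quadrant"
        using that by (intro exI[of _ "- 1 / b * x + k"]) (auto simp: \<eta> quadrant_def)
    next
      assume "\<exists>v\<ge>y. (x, v) \<in> \<eta> \<inter> quadrant"
      then have "y \<le> - 1 / b * x + k" by (auto simp: \<eta>)
      then show "x + b * y \<le> ?\<phi> w" unfolding M line .
    qed
    have "(x, y) \<in> enclosed_lattice_points (\<eta> \<inter> quadrant) \<longleftrightarrow> (x, y) \<in> T" for x y
    proof -
      have "(x, y) \<in> enclosed_lattice_points (\<eta> \<inter> quadrant) \<longleftrightarrow>
          0 \<le> x \<and> 0 \<le> y \<and> (\<exists>v\<ge>y. (x, v) \<in> \<eta> \<inter> quadrant) \<and> (x, y) \<in> lattice_points"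
        unfolding enclosed_lattice_points_def enclosed_region_def by blast
      also have "\<dots> \<longleftrightarrow> 0 \<le> x \<and> 0 \<le> y \<and> x + b * y \<le> ?\<phi> w \<and> (x, y) \<in> lattice_points"
        using iff[of x y] by blast
      finally show ?thesis by (auto simp: T_def quadrant_def)
    qed
    then show ?thesis by (intro set_eqI) (metis prod.collapse)
  qed
  have T_finite: "finite T"
  proof (rule finite_subset[OF _ lattice_box_finite])
    show "T \<subseteq> ({0..?\<phi> w} \<times> {0..?\<phi> w / b}) \<inter> lattice_points"
    proof
      fix p assume "p \<in> T"
      then have p: "0 \<le> fst p" "0 \<le> snd p" "?\<phi> p \<le> ?\<phi> w" "p \<in> lattice_points"
        by (auto simp: T_def quadrant_def)
      then have "0 \<le> b * snd p" using bc by simp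
      then have "fst p \<le> ?\<phi> w" "snd p * b \<le> ?\<phi> w" using p(1,3) by (simp_all add: mult.commute)
      then have "fst p \<le> ?\<phi> w" "snd p \<le> ?\<phi> w / b" using bc(1) by (simp_all only: pos_le_divide_eq)
      then show "p \<in> ({0..?\<phi> w} \<times> {0..?\<phi> w / b}) \<inter> lattice_points"
        using p by (cases p) auto
    qed
  qed
  have ET: "E \<subseteq> T"
  proof
    fix p assume "p \<in> E"
    then show "p \<in> T"
      using w(3)[of p] by (auto simp: E_def T_def enclosed_lattice_points_def enclosed_region_def quadrant_def)
  qed
  have max_iff: "maximal_under (gen_path \<Lambda>) (\<eta> \<inter> quadrant) \<longleftrightarrow> E = T"
    by (simp add: maximal_under_def T E_def)
  show ?thesis
    unfolding max_iff
  proof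
    assume E: "E = T"
    have "?A \<Lambda> < ?A \<Lambda>'"
      if \<Lambda>': "convex_generator \<Lambda>'" "purely_elliptic \<Lambda>'" "ech_index \<Lambda>' = ech_index \<Lambda>" "\<Lambda>' \<noteq> \<Lambda>" for \<Lambda>'
    proof (rule ccontr)
      assume contra: "\<not> ?thesis"
      define E' where "E' = enclosed_lattice_points (gen_path \<Lambda>')"
      obtain w' where w': "\<And>p. p \<in> enclosed_region (gen_path \<Lambda>') \<Longrightarrow> ?\<phi> p \<le> ?\<phi> w'"
        "?A \<Lambda>' = c * ?\<phi> w'"
        using generator_action[OF \<Lambda>'(1) bc] by metis
      have le: "?\<phi> w' \<le> ?\<phi> w" using contra w(4) w'(2) bc by simp
      have "?\<phi> p \<le> ?\<phi> w'" if "p \<in> E'" for p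
        using that w'(1) by (simp add: E'_def enclosed_lattice_points_def)
      then have "E' \<subseteq> T"
        using le by (fastforce simp: E'_def T_def enclosed_lattice_points_def enclosed_region_def quadrant_def)
      moreover have "card E' = card E"
        using \<Lambda>'(3) by (simp add: ech_index_elliptic \<Lambda>'(2) assms(4) E_def E'_def)
      ultimately have "E' = E" using E T_finite by (simp add: card_subset_eq)
      then have eq: "enclosed_lattice_points (gen_path \<Lambda>') = enclosed_lattice_points (gen_path \<Lambda>)"
        unfolding E_def E'_def .
      have "convex_integral_path (gen_path \<Lambda>')" "convex_integral_path (gen_path \<Lambda>)"
        using \<Lambda>'(1) assms(3) by (simp_all add: convex_generator_def)
      then have "gen_path \<Lambda>' = gen_path \<Lambda>" by (rule enclosed_lattice_points_inj[OF _ _ eq])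
      then have "\<Lambda>' = \<Lambda>"
        using elliptic_generator_eqI[OF \<Lambda>'(1,2) assms(3,4)] by simp
      then show False using \<Lambda>'(4) by simp
    qed
    then show "minimal_for (ellipsoid_region (b * c) c) \<Lambda>"
      using assms by (simp add: minimal_for_def)
  next
    assume min: "minimal_for (ellipsoid_region (b * c) c) \<Lambda>"
    show "E = T"
    proof (rule ccontr)
      assume "E \<noteq> T"
      then obtain q where q: "q \<in> T" "q \<notin> E" using ET by blast
      \<comment> \<open>The first \<open>card E\<close> points of \<open>T\<close> in the order of \<open>\<alpha> x + b y\<close> form a competitor of \<open>\<Lambda>\<close> of no
        larger action, so minimality forces them to be \<open>E\<close>.\<close>
      have first: "\<alpha> * fst w + b * snd w < \<alpha> * fst q + b * snd q"
        if \<alpha>: "0 < \<alpha>" and inj: "inj_on (\<lambda>p. \<alpha> * fst p + b * snd p) T" for \<alpha>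
      proof -
        obtain S where S: "S \<subseteq> T" "card S = card E"
          "\<And>s q. s \<in> S \<Longrightarrow> q \<in> T - S \<Longrightarrow> \<alpha> * fst s + b * snd s < \<alpha> * fst q + b * snd q"
          using initial_segment[OF T_finite inj, of "card E"] card_mono[OF T_finite ET] by metis
        have "card E \<noteq> 0" using w by auto
        then have S': "finite S" "S \<noteq> {}" using S by (auto intro: card_ge_0_finite)
        have "\<exists>\<alpha> \<beta> \<tau>. 0 \<le> \<alpha> \<and> 0 < \<beta> \<and> (\<forall>s\<in>S. \<alpha> * fst s + \<beta> * snd s \<le> \<tau>) \<and> \<tau> < \<alpha> * fst p + \<beta> * snd p"
          if p: "p \<in> quadrant \<inter> lattice_points - S" for p
        \<comment> \<open>Points outside \<open>T\<close> are cut off by the level line of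
          \<open>x + b y\<close> through \<open>w\<close>, those in \<open>T - S\<close> by the
          weight \<open>\<alpha>\<close>.\<close>
        proof (cases "p \<in> T")
          case False
          then show ?thesis
            using p S(1) bc by (intro exI[of _ 1] exI[of _ b] exI[of _ "?\<phi> w"]) (auto simp: T_def)
        next
          case True
          let ?\<kappa> = "\<lambda>p. \<alpha> * fst p + b * snd p"
          have "Max (?\<kappa> ` S) \<in> ?\<kappa> ` S" using S' by simp
          then have "Max (?\<kappa> ` S) < ?\<kappa> p" using S(3) True p by force
          then show ?thesis
            using \<alpha> bc S' by (intro exI[of _ \<alpha>] exI[of _ b] exI[of _ "Max (?\<kappa> ` S)"]) auto
        qed
        moreover have "S \<subseteq> quadrant \<inter> lattice_points" using S(1) by (auto simp: T_def)
        ultimately obtain P where P: "convex_integral_path P" "enclosed_lattice_points P = S"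
          using lattice_hull S' by metis
        obtain \<Lambda>' where \<Lambda>': "convex_generator \<Lambda>'" "purely_elliptic \<Lambda>'" "gen_path \<Lambda>' = P"
          using exists_elliptic_generator[OF P(1)] .
        \<comment> \<open>The maximizer of the competitor belongs to \<open>S \<subseteq> T\<close>,
          which bounds its action by that of \<open>\<Lambda>\<close>.\<close>
        have "\<exists>w'\<in>S. ?A \<Lambda>' = c * ?\<phi> w'"
          using generator_action[OF \<Lambda>'(1) bc] unfolding \<Lambda>'(3) P(2) by metis
        then have "?A \<Lambda>' \<le> ?A \<Lambda>" using S(1) w(4) bc by (auto simp: T_def)
        moreover have "ech_index \<Lambda>' = ech_index \<Lambda>"
          using S(2) \<Lambda>' P by (simp add: ech_index_elliptic assms(4) E_def)
        ultimately have "\<Lambda>' = \<Lambda>" using min \<Lambda>' unfolding minimal_for_def by force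
        then have "E = S" using \<Lambda>' P by (simp add: E_def)
        then show ?thesis using S(3)[of w q] w q by simp
      qed
      obtain \<alpha>\<^sub>1 where \<alpha>\<^sub>1: "0 < \<alpha>\<^sub>1" "\<alpha>\<^sub>1 < 1" "inj_on (\<lambda>p. \<alpha>\<^sub>1 * fst p + b * snd p) T"
        using generic_weight[OF T_finite, of b 0 1] bc by auto
      obtain \<alpha>\<^sub>2 where \<alpha>\<^sub>2: "1 < \<alpha>\<^sub>2" "\<alpha>\<^sub>2 < 2" "inj_on (\<lambda>p. \<alpha>\<^sub>2 * fst p + b * snd p) T"
        using generic_weight[OF T_finite, of b 1 2] bc by auto
      have lt: "0 < \<alpha>\<^sub>1 * (fst q - fst w) + b * (snd q - snd w)" "0 < \<alpha>\<^sub>2 * (fst q - fst w) + b * (snd q - snd w)"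
        using first[of \<alpha>\<^sub>1] first[of \<alpha>\<^sub>2] \<alpha>\<^sub>1 \<alpha>\<^sub>2 by (simp_all add: algebra_simps)
      \<comment> \<open>Replacing the weight by 1 does not decrease the first term: start from
        \<open>\<alpha>\<^sub>1\<close> if \<open>q\<close> is not to the left of \<open>w\<close>,
        and from \<open>\<alpha>\<^sub>2\<close> otherwise.\<close>
      have "0 < 1 * (fst q - fst w) + b * (snd q - snd w)"
      proof (cases "0 \<le> fst q - fst w")
        case True
        then show ?thesis
          using lt(1) mult_right_mono[of \<alpha>\<^sub>1 1 "fst q - fst w"] \<alpha>\<^sub>1 by linarith
      next
        case False
        then show ?thesis
          using lt(2) mult_right_mono_neg[of 1 \<alpha>\<^sub>2 "fst q - fst w"] \<alpha>\<^sub>2 by linarith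
      qed
      then have "?\<phi> w < ?\<phi> q" by (simp add: algebra_simps)
      then show False using q by (simp add: T_def)
    qed
  qed
qed

end
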